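(* For every odd integer $n\geq 5$, $R(S_n(1,1),W_8)=2n+1$.
   Context: All graphs are finite, simple, undirected. For graphs $G,H$, the Ramsey number $R(G,H)$ is the smallest positive integer $N$ such that for every graph $F$ on $N$ vertices, either $F$ contains a subgraph isomorphic to $G$ or the complement $\overline{F}$ contains a subgraph isomorphic to $H$. $W_8$ is the wheel on 9 vertices: a cycle $C_8$ plus one vertex adjacent to all its vertices. $S_n(1,1)$ denotes the tree of order $n$ obtained from the star on $n-1$ vertices by subdividing one edge once. *)

theory Defs
  imports "Graph_Theory.Graph_Theory"
begin

text \<open>
  A finite simple undirected graph is a \<^locale>\<open>pair_graph\<close>: a finite, loop-free digraph
  with a symmetric arc relation, so that an edge is a pair of opposite arcs.
\<close>

definition complement_graph :: "'a pair_pre_digraph \<Rightarrow> 'a pair_pre_digraph" where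
  "complement_graph F =
     \<lparr> pverts = pverts F,
       parcs = {(u, v). u \<in> pverts F \<and> v \<in> pverts F \<and> u \<noteq> v \<and> (u, v) \<notin> parcs F} \<rparr>"

definition contains_copy :: "'a pair_pre_digraph \<Rightarrow> 'b pair_pre_digraph \<Rightarrow> bool" where
  "contains_copy F G \<longleftrightarrow> (\<exists>H. subgraph H (with_proj F) \<and> digraph_iso (with_proj G) H)"

text \<open>
  The host graphs may have any finite set of natural numbers as vertex set; every finite graph is
  isomorphic to one of these. Ramsey's theorem ensures that the minimum exists.
\<close>

definition ramsey_number :: "'a pair_pre_digraph \<Rightarrow> 'b pair_pre_digraph \<Rightarrow> nat" where
  "ramsey_number G H =
     (LEAST N. 0 < N \<and>
        (\<forall>F :: nat pair_pre_digraph. pair_graph F \<and> card (pverts F) = N \<longrightarrow>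
           contains_copy F G \<or> contains_copy (complement_graph F) H))"

text \<open>The cycle \<open>C\<^sub>k\<close> on \<open>0, \<dots>, k - 1\<close>, intended for \<open>k \<ge> 3\<close>.\<close>

definition cycle_graph :: "nat \<Rightarrow> nat pair_pre_digraph" where
  "cycle_graph k =
     \<lparr> pverts = {..<k},
       parcs = {(i, j). i < k \<and> j < k \<and> (j = Suc i mod k \<or> i = Suc j mod k)} \<rparr>"

text \<open>The wheel \<open>W\<^sub>k\<close> has order \<open>k + 1\<close>: its rim is \<open>C\<^sub>k\<close> and its hub is the vertex \<open>k\<close>.\<close>

definition wheel_graph :: "nat \<Rightarrow> nat pair_pre_digraph" where
  "wheel_graph k =
     \<lparr> pverts = insert k (pverts (cycle_graph k)),
       parcs = parcs (cycle_graph k) \<union> {k} \<times> pverts (cycle_graph k) \<union> pverts (cycle_graph k) \<times> {k} \<rparr>"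

text \<open>The star of order \<open>m\<close> (with \<open>m - 1\<close> leaves), centred at \<open>0\<close>.\<close>

definition star_graph :: "nat \<Rightarrow> nat pair_pre_digraph" where
  "star_graph m = \<lparr> pverts = {..<m}, parcs = {0} \<times> {1..<m} \<union> {1..<m} \<times> {0} \<rparr>"

text \<open>
  \<open>S\<^sub>n(1,1)\<close>: the edge between \<open>0\<close> and \<open>1\<close> of the star of order \<open>n - 1\<close> is subdivided by the new
  vertex \<open>n - 1\<close>. This requires \<open>n \<ge> 3\<close>; by symmetry the choice of the edge is immaterial.
\<close>

definition subdivided_star :: "nat \<Rightarrow> nat pair_pre_digraph" where
  "subdivided_star n = subdivide (star_graph (n - 1)) (0, 1) (n - 1)"

end

theory Submission
  imports Defs
begin

text \<open>
  Upper bound: let \<open>E\<close> be the complement of the host graph, on \<open>2n + 1\<close> vertices. If some vertex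
  has degree at least \<open>n - 2\<close> in the host but there is no \<open>S\<^sub>n(1,1)\<close>, then \<open>E\<close> contains almost a
  complete bipartite graph and a wheel is easily found; oddness of \<open>n\<close> enters because the
  remaining \<open>n + 2\<close> vertices would otherwise have to induce a cubic graph. So all degrees in \<open>E\<close> are at least
  \<open>n + 3\<close>. Fix a hub \<open>v\<close> and a set \<open>M\<close> of \<open>n + 3\<close> of its neighbours. For \<open>u \<in> M\<close>, a 7-vertex path
  with both ends in \<open>N(u)\<close> inside \<open>N(v)\<close> closes up through \<open>u\<close> to the rim of a wheel. A graph on \<open>q \<ge> 8\<close>
  vertices without such a path has at most \<open>3q - 6\<close> edges meeting the set of allowed ends.
  Applied with hub \<open>v\<close> and again with hub \<open>u\<close>, and summed, this gives \<open>(d - 6)(d - n) \<ge> 0\<close> for the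
  degree \<open>d\<close> of \<open>u\<close> in \<open>M\<close>. Hence each degree in \<open>M\<close> is at most 6 or at least \<open>n\<close>, at most three are of
  the second kind, and the rim can be written down explicitly. The cases \<open>n = 5\<close> and \<open>n = 7\<close> need
  separate arguments along the same lines.

  Lower bound: take the disjoint union of \<open>K\<^bsub>n-1\<^esub>\<close> and the complement of a cubic graph on \<open>n + 1\<close>
  vertices all of whose components are small.
\<close>

section \<open>Paths through an independent set\<close>

definition nbhd :: "('a \<Rightarrow> 'a \<Rightarrow> bool) \<Rightarrow> 'a set \<Rightarrow> 'a \<Rightarrow> 'a set" where
  "nbhd E W x = {y \<in> W. E x y}"

text \<open>For a symmetric irreflexive relation this is twice the number of edges, so edge bounds
  can be stated without forming sets of edges.\<close>

definition degsum :: "('a \<Rightarrow> 'a \<Rightarrow> bool) \<Rightarrow> 'a set \<Rightarrow> nat" where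
  "degsum E W = (\<Sum>x\<in>W. card (nbhd E W x))"

text \<open>The ends are confined to \<open>S\<close> because later \<open>S\<close> consists of
  common neighbours of a hub and of one further vertex, and that vertex closes the path to a cycle.
  Lengths of such paths count vertices.\<close>

definition spath :: "('a \<Rightarrow> 'a \<Rightarrow> bool) \<Rightarrow> 'a set \<Rightarrow> 'a set \<Rightarrow> 'a list \<Rightarrow> bool" where
  "spath E S T xs \<longleftrightarrow> xs \<noteq> [] \<and> distinct xs \<and> set xs \<subseteq> S \<union> T \<and> successively E xs
     \<and> hd xs \<in> S \<and> last xs \<in> S"

lemma nbhd_subset: "nbhd E W x \<subseteq> W"
  by (auto simp: nbhd_def)

lemma finite_nbhd [simp]: "finite W \<Longrightarrow> finite (nbhd E W x)"
  by (auto simp: nbhd_def)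

locale split_graph =
  fixes E :: "'a \<Rightarrow> 'a \<Rightarrow> bool" and S T :: "'a set"
  assumes finite_S: "finite S" and finite_T: "finite T" and disjoint: "S \<inter> T = {}"
    and sym: "\<And>x y. E x y \<Longrightarrow> E y x" and irrefl: "\<And>x. \<not> E x x"
    and indep: "\<And>x y. x \<in> T \<Longrightarrow> y \<in> T \<Longrightarrow> \<not> E x y"
begin

abbreviation "W \<equiv> S \<union> T"

lemma E_commute: "E x y \<longleftrightarrow> E y x"
  using sym by blast

lemma finite_W: "finite W"
  using finite_S finite_T by simp

lemma nbhd_T: "t \<in> T \<Longrightarrow> nbhd E W t \<subseteq> S"
  using indep by (auto simp: nbhd_def)

end

section \<open>Minimum degree four without an admissible path on seven vertices\<close>

locale split_graph_core = split_graph +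
  assumes no7: "\<And>xs. spath E S T xs \<Longrightarrow> length xs \<noteq> 7"
    and deg4: "\<And>x. x \<in> W \<Longrightarrow> 4 \<le> card (nbhd E W x)"
begin

lemma no7_list:
  assumes "distinct [a, b, c, d, e, f, g]" "a \<in> S" "g \<in> S" "{b, c, d, e, f} \<subseteq> W"
    "E a b" "E b c" "E c d" "E d e" "E e f" "E f g"
  shows False
  using no7[of "[a, b, c, d, e, f, g]"] assms by (auto simp: spath_def)

lemma nbhd_not_subset:
  assumes "x \<in> W" "length as < 4"
  obtains y where "y \<in> W" "E x y" "y \<notin> set as"
proof -
  have "\<not> nbhd E W x \<subseteq> set as"
    using card_mono[of "set as" "nbhd E W x"] deg4[OF assms(1)] card_length[of as] assms by force
  then show ?thesis
    using that by (auto simp: nbhd_def)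
qed

text \<open>With \<open>p2\<close> and \<open>p7\<close> in \<open>T\<close> the path cannot be
  trimmed to seven vertices at an end, so it is rerouted. The vertex \<open>p1\<close> has a
  neighbour \<open>y\<close> other than \<open>p2\<close> and \<open>p4\<close>. Every other place
  of \<open>y\<close> on the path, and every place in \<open>S\<close> off it, gives seven vertices
  at once; a new \<open>y\<close> in \<open>T\<close> does so after one more step to a neighbour
  \<open>z\<close>.\<close>

lemma no_path8_SS:
  assumes d: "distinct [p1, p2, p3, p4, p5, p6, p7, p8]"
    and SS: "p1 \<in> S" "p3 \<in> S" "p4 \<in> S" "p5 \<in> S" "p6 \<in> S" "p8 \<in> S" and TT: "p2 \<in> T" "p7 \<in> T"
    and EE: "E p1 p2" "E p2 p3" "E p3 p4" "E p4 p5" "E p5 p6" "E p6 p7" "E p7 p8"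
  shows False
proof -
  have EE': "E p2 p1" "E p3 p2" "E p4 p3" "E p5 p4" "E p6 p5" "E p7 p6" "E p8 p7"
    using EE sym by blast+
  obtain y where y: "y \<in> W" "E p1 y" "y \<notin> {p2, p4}"
    using nbhd_not_subset[of p1 "[p2, p4]"] SS by auto
  have y': "E y p1" using y sym by blast
  have "y \<noteq> p1" using y irrefl by blast
  moreover have "y \<noteq> p3"
    using no7_list[of p1 p3 p4 p5 p6 p7 p8] y d SS TT EE by auto
  moreover have "y \<noteq> p5"
    using no7_list[of p3 p2 p1 p5 p6 p7 p8] y d SS TT EE EE' by auto
  moreover have "y \<noteq> p6"
    using no7_list[of p4 p3 p2 p1 p6 p7 p8] y d SS TT EE EE' by auto
  moreover have "y \<noteq> p7"
    using no7_list[of p4 p5 p6 p7 p1 p2 p3] y y' d SS TT EE EE' by auto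
  moreover have "y \<noteq> p8"
    using no7_list[of p3 p4 p5 p6 p7 p8 p1] y y' d SS TT EE EE' by auto
  moreover have "y \<notin> S" if "y \<notin> {p1, p2, p3, p4, p5, p6, p7, p8}"
    using no7_list[of y p1 p2 p3 p4 p5 p6] that y y' d SS TT EE EE' by auto
  ultimately have yT: "y \<in> T" and yo: "y \<notin> {p1, p2, p3, p4, p5, p6, p7, p8}"
    using y by auto
  obtain z where z: "z \<in> W" "E y z" "z \<notin> {p1, p3, p4}"
    using nbhd_not_subset[of y "[p1, p3, p4]"] yT by auto
  have zS: "z \<in> S" and z': "E z y"
    using z yT indep sym by blast+
  show False
  proof (cases "z = p5")
    case True
    then show False
      using no7_list[of p4 p3 p2 p1 y p5 p6] z y' y yo yT d SS TT EE EE' by auto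
  next
    case False
    have "z \<noteq> p2" "z \<noteq> y" using zS TT yT disjoint by auto
    then show False
      using no7_list[of z y p1 p2 p3 p4 p5] z z' zS False y' y yo yT d SS TT EE EE' by auto
  qed
qed

text \<open>The rerouting now starts at \<open>p8\<close>: its extra neighbour \<open>y\<close> must
  be a new vertex of \<open>T\<close>, and any neighbour \<open>z\<close> of \<open>y\<close> off
  \<open>p4\<close>, \<open>p6\<close>, \<open>p8\<close> ends the seven-vertex path that runs from
  \<open>p4\<close> through \<open>p8\<close> and \<open>y\<close>.\<close>

lemma no_path8_ST:
  assumes d: "distinct [p1, p2, p3, p4, p5, p6, p7, p8]"
    and SS: "p1 \<in> S" "p3 \<in> S" "p4 \<in> S" "p6 \<in> S" "p8 \<in> S" and TT: "p2 \<in> T" "p5 \<in> T" "p7 \<in> T"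
    and EE: "E p1 p2" "E p2 p3" "E p3 p4" "E p4 p5" "E p5 p6" "E p6 p7" "E p7 p8"
  shows False
proof -
  have EE': "E p2 p1" "E p3 p2" "E p4 p3" "E p5 p4" "E p6 p5" "E p7 p6" "E p8 p7"
    using EE sym by blast+
  obtain y where y: "y \<in> W" "E p8 y" "y \<notin> {p7, p5, p3}"
    using nbhd_not_subset[of p8 "[p7, p5, p3]"] SS by auto
  have y': "E y p8" using y sym by blast
  have "y \<noteq> p8" using y irrefl by blast
  moreover have "y \<noteq> p6"
    using no7_list[of p1 p2 p3 p4 p5 p6 p8] y y' d SS TT EE by auto
  moreover have "y \<noteq> p4"
    using no7_list[of p1 p2 p3 p4 p8 p7 p6] y y' d SS TT EE EE' by auto
  moreover have "y \<noteq> p2"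
    using no7_list[of p4 p5 p6 p7 p8 p2 p3] y y' d SS TT EE EE' by auto
  moreover have "y \<noteq> p1"
    using no7_list[of p3 p4 p5 p6 p7 p8 p1] y y' d SS TT EE EE' by auto
  moreover have "y \<notin> S" if "y \<notin> {p1, p2, p3, p4, p5, p6, p7, p8}"
    using no7_list[of p3 p4 p5 p6 p7 p8 y] that y y' d SS TT EE EE' by auto
  ultimately have yT: "y \<in> T" and yo: "y \<notin> {p1, p2, p3, p4, p5, p6, p7, p8}"
    using y by auto
  obtain z where z: "z \<in> W" "E y z" "z \<notin> {p4, p6, p8}"
    using nbhd_not_subset[of y "[p4, p6, p8]"] yT by auto
  have zS: "z \<in> S" and z': "E z y"
    using z yT indep sym by blast+
  have "z \<noteq> p5" "z \<noteq> p7" "z \<noteq> y" using zS TT yT disjoint by auto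
  then show False
    using no7_list[of p4 p5 p6 p7 p8 y z] z z' zS y' y yo yT d SS TT EE EE' by auto
qed

lemma no_path8:
  assumes d: "distinct [p1, p2, p3, p4, p5, p6, p7, p8]"
    and SS: "p1 \<in> S" "p3 \<in> S" "p6 \<in> S" "p8 \<in> S" and TT: "p2 \<in> T" "p7 \<in> T" and W: "p4 \<in> W" "p5 \<in> W"
    and EE: "E p1 p2" "E p2 p3" "E p3 p4" "E p4 p5" "E p5 p6" "E p6 p7" "E p7 p8"
  shows False
proof -
  have EE': "E p2 p1" "E p3 p2" "E p4 p3" "E p5 p4" "E p6 p5" "E p7 p6" "E p8 p7"
    using EE sym by blast+
  consider "p4 \<in> S" "p5 \<in> S" | "p4 \<in> S" "p5 \<in> T" | "p4 \<in> T" "p5 \<in> S"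
    using W EE indep by blast
  then show False
  proof cases
    case 1 then show False using no_path8_SS[OF d] SS TT EE by blast
  next
    case 2 then show False using no_path8_ST[OF d] SS TT EE by blast
  next
    case 3
    have "distinct [p8, p7, p6, p5, p4, p3, p2, p1]" using d by auto
    from no_path8_ST[OF this] show False using 3 SS TT EE' by blast
  qed
qed

text \<open>Dropping the first vertex, or the first two if the second lies in \<open>T\<close>,
  leaves an admissible path, which by induction has at most six vertices. So a counterexample has
  exactly eight vertices, with the second and the seventh in \<open>T\<close>, which is the case
  settled by \<open>no_path8\<close>.\<close>

lemma spath_length: "spath E S T xs \<Longrightarrow> length xs \<le> 6"
proof (induction "length xs" arbitrary: xs rule: less_induct)
  case less
  show ?case
  proof (rule ccontr)
    assume "\<not> length xs \<le> 6"
    with no7[OF less.prems] have len: "length xs \<ge> 8" by linarith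
    then obtain a b c ys where xs: "xs = a # b # c # ys"
      by (auto simp: numeral_eq_Suc Suc_le_length_iff)
    have ylen: "length ys \<ge> 5" using len xs by simp
    have p: "distinct xs" "set xs \<subseteq> W" "successively E xs" "a \<in> S" "last xs \<in> S"
      using less.prems xs by (auto simp: spath_def)
    have bT: "b \<in> T"
    proof (rule ccontr)
      assume "b \<notin> T"
      then have "spath E S T (b # c # ys)" using p xs by (auto simp: spath_def split: if_splits)
      from less.hyps[OF _ this] show False using xs ylen by simp
    qed
    then have cS: "c \<in> S" using p indep xs by auto
    have c8: "length xs = 8"
    proof (rule ccontr)
      assume "length xs \<noteq> 8"
      moreover have "spath E S T (c # ys)" using p xs cS ylen by (auto simp: spath_def split: if_splits)
      from less.hyps[OF _ this] have "length (c # ys) \<le> 6" using xs by simp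
      ultimately show False using xs len by simp
    qed
    then obtain d e f g h where ys: "ys = [d, e, f, g, h]"
      using xs by (auto simp: numeral_eq_Suc length_Suc_conv)
    have gT: "g \<in> T"
    proof (rule ccontr)
      assume "g \<notin> T"
      then have "spath E S T [a, b, c, d, e, f, g]" using p xs ys by (auto simp: spath_def)
      from no7[OF this] show False by simp
    qed
    have fS: "f \<in> S" using gT p indep xs ys by auto
    show False
      using no_path8[of a b c d e f g h] p xs ys bT cS gT fS by auto
  qed
qed

end

section \<open>Pigeonhole for consecutive list entries\<close>

lemma not_successivelyD:
  "\<not> successively P xs \<Longrightarrow> \<exists>us a b vs. xs = us @ a # b # vs \<and> \<not> P a b"
proof (induction xs rule: induct_list012)
  case (3 x y zs)
  show ?case
  proof (cases "P x y")
    case True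
    with 3 obtain us a b vs where "y # zs = us @ a # b # vs" "\<not> P a b" by auto
    then have "x # y # zs = (x # us) @ a # b # vs \<and> \<not> P a b" by simp
    then show ?thesis by blast
  next
    case False
    then have "x # y # zs = [] @ x # y # zs \<and> \<not> P x y" by simp
    then show ?thesis by blast
  qed
qed auto

lemma length_filter_nonconsecutive:
  "successively (\<lambda>a b. \<not> (a \<in> A \<and> b \<in> A)) xs \<Longrightarrow> 2 * length (filter (\<lambda>x. x \<in> A) xs) \<le> length xs + 1"
proof (induction xs rule: induct_list012)
  case (3 x y zs)
  then have *: "2 * length (filter (\<lambda>x. x \<in> A) zs) \<le> length zs + 1"
    and **: "\<not> (x \<in> A \<and> y \<in> A)"
    by (auto simp: successively_Cons)
  then show ?case by auto
qed auto

text \<open>Four members among at most six entries include two neighbouring ones. An outside vertex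
  with four neighbours on a path or cycle can therefore be inserted between two consecutive
  vertices.\<close>

lemma consecutive_in_listE:
  assumes "distinct xs" "finite A" "A \<subseteq> set xs" "length xs + 1 < 2 * card A"
  obtains us a b vs where "xs = us @ a # b # vs" "a \<in> A" "b \<in> A"
proof -
  have "set (filter (\<lambda>x. x \<in> A) xs) = A" using assms by auto
  then have "card A = length (filter (\<lambda>x. x \<in> A) xs)"
    using distinct_card[of "filter (\<lambda>x. x \<in> A) xs"] assms by simp
  then have "\<not> successively (\<lambda>a b. \<not> (a \<in> A \<and> b \<in> A)) xs"
    using length_filter_nonconsecutive[of A xs] assms by linarith
  then obtain us a b vs where "xs = us @ a # b # vs" "\<not> \<not> (a \<in> A \<and> b \<in> A)"
    using not_successivelyD by blast
  then show thesis using that by blast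
qed

section \<open>Longest admissible paths span components\<close>

context split_graph_core
begin

text \<open>An outside neighbour \<open>y\<close> of the head prolongs the path if it lies in
  \<open>S\<close>. If it lies in \<open>T\<close>, a neighbour of \<open>y\<close> off the path
  would be a new end, so all its neighbours are on the path; two of them are consecutive and
  \<open>y\<close> fits between them.\<close>

lemma longest_end_closed:
  assumes P: "spath E S T xs" and longest: "\<And>ys. spath E S T ys \<Longrightarrow> length ys \<le> length xs"
  shows "nbhd E W (hd xs) \<subseteq> set xs"
proof
  fix y assume "y \<in> nbhd E W (hd xs)"
  then have y: "y \<in> W" "E (hd xs) y" "E y (hd xs)" using sym by (auto simp: nbhd_def)
  obtain p ps where xs: "xs = p # ps" using P by (cases xs) (auto simp: spath_def)
  have p: "distinct xs" "set xs \<subseteq> W" "successively E xs" "p \<in> S" "last xs \<in> S" "length xs \<le> 6"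
    using P xs spath_length[OF P] by (auto simp: spath_def)
  show "y \<in> set xs"
  proof (rule ccontr)
    assume no: "y \<notin> set xs"
    have yT: "y \<in> T"
    proof (rule ccontr)
      assume "y \<notin> T"
      then have "spath E S T (y # xs)" using y p no xs by (auto simp: spath_def)
      from longest[OF this] show False by simp
    qed
    have "nbhd E W y \<subseteq> set xs"
    proof
      fix z assume "z \<in> nbhd E W y"
      then have z: "z \<in> S" "E z y" using nbhd_T[OF yT] sym by (auto simp: nbhd_def)
      show "z \<in> set xs"
      proof (rule ccontr)
        assume "z \<notin> set xs"
        moreover have "z \<noteq> y" using z yT disjoint by auto
        ultimately have "spath E S T (z # y # xs)" using z y p no xs by (auto simp: spath_def)
        from longest[OF this] show False by simp
      qed
    qed
    moreover have "length xs + 1 < 2 * card (nbhd E W y)" using deg4[OF y(1)] p by linarith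
    ultimately obtain us a b vs where s: "xs = us @ a # b # vs" "a \<in> nbhd E W y" "b \<in> nbhd E W y"
      using consecutive_in_listE[OF p(1)] finite_nbhd[OF finite_W] by metis
    have ab: "E a y" "E y b" using s sym by (auto simp: nbhd_def)
    have "hd (us @ a # y # b # vs) \<in> S" "last (us @ a # y # b # vs) \<in> S"
      using s(1) P by (cases us; auto simp: spath_def)+
    then have "spath E S T (us @ a # y # b # vs)"
      using p ab no y s(1) by (auto simp: spath_def successively_append_iff)
    from longest[OF this] show False using s(1) by simp
  qed
qed

definition "cyc cs \<longleftrightarrow> distinct cs \<and> set cs \<subseteq> W \<and> successively E cs \<and> E (last cs) (hd cs)"

lemma cyc_rotate: "cyc (us @ vs) \<Longrightarrow> us \<noteq> [] \<Longrightarrow> vs \<noteq> [] \<Longrightarrow> cyc (vs @ us)"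
  by (auto simp: cyc_def successively_append_iff)

lemma cyc_rev: "cyc cs \<Longrightarrow> cs \<noteq> [] \<Longrightarrow> cyc (rev cs)"
  using E_commute by (auto simp: cyc_def hd_rev last_rev successively_rev)

lemma rotate_to_head:
  assumes "cyc cs" "c \<in> set cs"
  obtains ds where "cyc (c # ds)" "set (c # ds) = set cs" "length (c # ds) = length cs"
proof -
  obtain us vs where cs: "cs = us @ c # vs" using assms by (meson split_list)
  show thesis
  proof (cases "us = []")
    case True then show thesis using that assms cs by simp
  next
    case False
    then have "cyc (c # vs @ us)" using cyc_rotate[of us "c # vs"] assms cs by simp
    then show thesis using that[of "vs @ us"] cs by auto
  qed
qed

text \<open>Each end has its four or more neighbours on the path. On five vertices this forces the
  closing edge. On six vertices without the closing edge, both ends are joined to all four inner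
  vertices, and these chords yield another spanning cycle.\<close>

lemma longest_to_cyc:
  assumes P: "spath E S T xs" and longest: "\<And>ys. spath E S T ys \<Longrightarrow> length ys \<le> length xs"
  obtains cs where "cyc cs" "set cs = set xs" "length cs = length xs" "5 \<le> length cs" "length cs \<le> 6"
proof -
  have p: "distinct xs" "set xs \<subseteq> W" "successively E xs" "xs \<noteq> []"
    using P by (auto simp: spath_def)
  have h: "nbhd E W (hd xs) \<subseteq> set xs" by (rule longest_end_closed[OF P longest])
  have P': "spath E S T (rev xs)"
    using P E_commute by (auto simp: spath_def hd_rev last_rev successively_rev)
  have l: "nbhd E W (last xs) \<subseteq> set xs"
    using longest_end_closed[OF P'] longest p by (simp add: hd_rev)
  have "nbhd E W (hd xs) \<subseteq> set xs - {hd xs}" using h irrefl by (auto simp: nbhd_def)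
  then have "4 \<le> card (set xs - {hd xs})"
    using deg4[of "hd xs"] p card_mono[of "set xs - {hd xs}" "nbhd E W (hd xs)"]
    by (metis List.finite_set finite_Diff hd_in_set le_trans subsetD)
  then have "5 \<le> length xs"
    using p by (simp add: card_Diff_singleton_if distinct_card)
  moreover have len: "length xs \<le> 6" by (rule spath_length[OF P])
  ultimately consider "length xs = 5" | "length xs = 6" by linarith
  then show thesis
  proof cases
    case 1
    then obtain p1 p2 p3 p4 p5 where xs: "xs = [p1, p2, p3, p4, p5]"
      by (auto simp: numeral_eq_Suc length_Suc_conv)
    obtain y where "y \<in> W" "E p1 y" "y \<notin> set [p2, p3, p4]"
      using nbhd_not_subset[of p1 "[p2, p3, p4]"] p xs by auto
    then have "E p1 p5" using h xs irrefl by (auto simp: nbhd_def)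
    then have "cyc xs" using p xs sym by (auto simp: cyc_def)
    then show thesis using that 1 by simp
  next
    case 2
    then obtain p1 p2 p3 p4 p5 p6 where xs: "xs = [p1, p2, p3, p4, p5, p6]"
      by (auto simp: numeral_eq_Suc length_Suc_conv)
    show thesis
    proof (cases "E p1 p6")
      case True
      then have "cyc xs" using p xs sym by (auto simp: cyc_def)
      then show thesis using that 2 by simp
    next
      case False
      obtain y where "y \<in> W" "E p1 y" "y \<notin> set [p2, p4, p5]"
        using nbhd_not_subset[of p1 "[p2, p4, p5]"] p xs by auto
      then have 3: "E p1 p3" using h xs irrefl False by (auto simp: nbhd_def)
      obtain y where "y \<in> W" "E p6 y" "y \<notin> set [p3, p4, p5]"
        using nbhd_not_subset[of p6 "[p3, p4, p5]"] p xs by auto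
      then have "E p6 p2" using l xs irrefl False E_commute by (auto simp: nbhd_def)
      then have "cyc [p1, p3, p4, p5, p6, p2]" using 3 p xs sym by (auto simp: cyc_def)
      then show thesis using that[of "[p1, p3, p4, p5, p6, p2]"] xs by auto
    qed
  qed
qed

text \<open>Opening the cycle at the point of attachment and putting \<open>w\<close> in front gives
  a path that is too long, unless one of its ends falls in \<open>T\<close>. The two cases for
  \<open>w\<close> deal with that obstacle.\<close>

lemma longest_cyc_closed:
  assumes cs: "cyc cs" "5 \<le> length cs" "length cs \<le> 6"
    and longest: "\<And>ys. spath E S T ys \<Longrightarrow> length ys \<le> length cs"
    and c: "c \<in> set cs" and w: "w \<in> W" "E w c"
  shows "w \<in> set cs"
proof (rule ccontr)
  assume wn: "w \<notin> set cs"
  have wc: "E c w" using w sym by blast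
  have dcs: "distinct cs" "set cs \<subseteq> W" using cs by (auto simp: cyc_def)
  obtain ds where ds: "cyc (c # ds)" "set (c # ds) = set cs" "length (c # ds) = length cs"
    using rotate_to_head[OF cs(1) c] by metis
  have dl: "length ds \<ge> 4" using ds cs by simp
  obtain es d where esd: "ds = es @ [d]" using dl by (cases ds rule: rev_cases) auto
  have es: "es \<noteq> []" using dl esd by auto
  have dsp: "distinct (c # ds)" "set (c # ds) \<subseteq> W" "successively E (c # ds)" "E d c"
    using ds esd by (auto simp: cyc_def)
  have lasts: "last es \<in> W"
    using dsp(2) last_in_set[OF es] unfolding esd set_simps set_append by blast
  have laste: "E (last es) d"
    using dsp es unfolding esd by (auto simp: successively_append_iff successively_Cons)
  have wo: "w \<notin> set (c # ds)" using wn ds by simp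
  show False
  proof (cases "w \<in> S")
    case True
    \<comment> \<open>Whenever \<open>w\<close> is adjacent to a vertex of the cycle, the neighbours
      of that vertex along the cycle lie in \<open>T\<close>. Rotation and reflection are both
      covered by the free choice of \<open>a\<close> and \<open>zs\<close>.\<close>
    have step: "last zs \<in> T" if z: "cyc (a # zs)" "set (a # zs) = set cs" "length (a # zs) = length cs" "E w a"
      for a zs
    proof (rule ccontr)
      assume "last zs \<notin> T"
      moreover have "zs \<noteq> []" using z cs by auto
      ultimately have "spath E S T (w # a # zs)"
        using z True wn by (auto simp: spath_def cyc_def)
      from longest[OF this] show False using z by simp
    qed
    have dT: "d \<in> T" using step[OF ds(1,2,3) w(2)] esd by simp
    then have lS: "last es \<in> S" using lasts laste indep by blast
    \<comment> \<open>Exchanging \<open>d\<close> for \<open>w\<close> keeps the maximal length, so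
      the neighbours of the end \<open>w\<close> all lie on this path.\<close>
    have "spath E S T (w # c # es)"
      using True w dsp wo lS es unfolding esd by (auto simp: spath_def successively_append_iff successively_Cons)
    moreover have "\<And>ys. spath E S T ys \<Longrightarrow> length ys \<le> length (w # c # es)"
      using longest ds esd by simp
    ultimately have "nbhd E W w \<subseteq> set (w # c # es)"
      using longest_end_closed[of "w # c # es"] by simp
    then have sub: "nbhd E W w \<subseteq> set cs"
      using irrefl ds(2) esd by (auto simp: nbhd_def)
    moreover have "length cs + 1 < 2 * card (nbhd E W w)" using deg4[OF w(1)] cs by linarith
    ultimately obtain us a b vs where s: "cs = us @ a # b # vs" "a \<in> nbhd E W w" "b \<in> nbhd E W w"
      using consecutive_in_listE[OF dcs(1)] finite_nbhd[OF finite_W] by metis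
    have ab: "E w a" "E w b" "E a b" using s cs by (auto simp: nbhd_def cyc_def successively_append_iff)
    have r1: "cyc (b # (vs @ us @ [a]))"
      using cyc_rotate[of "us @ [a]" "b # vs"] cs(1) s(1) by simp
    have "last (vs @ us @ [a]) \<in> T"
      by (rule step[OF r1]) (use s ab in auto)
    then have aT: "a \<in> T" by simp
    have r2: "cyc (rev (b # vs @ us @ [a]))" using cyc_rev[OF r1] by simp
    then have r3: "cyc (a # (rev us @ rev vs @ [b]))" by simp
    have "last (rev us @ rev vs @ [b]) \<in> T"
      by (rule step[OF r3]) (use s ab in auto)
    then have "b \<in> T" by simp
    then show False using aT ab indep by blast
  next
    case False
    then have wT: "w \<in> T" using w by blast
    have cS: "c \<in> S" using c dcs indep wT w by blast
    have sub: "nbhd E W w \<subseteq> set cs"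
    proof
      fix z assume "z \<in> nbhd E W w"
      then have z: "z \<in> S" "E z w" using nbhd_T[OF wT] sym by (auto simp: nbhd_def)
      show "z \<in> set cs"
      proof (rule ccontr)
        assume "z \<notin> set cs"
        then have zn: "z \<notin> set (c # ds)" "z \<noteq> w" using ds z wT disjoint by auto
        show False
        proof (cases "d \<in> S")
          case True
          then have "spath E S T (z # w # c # ds)"
            using z w wo zn dsp esd by (auto simp: spath_def)
          from longest[OF this] show False using ds by simp
        next
          case False
          then have "last es \<in> S" using lasts laste False indep dsp esd by auto
          then have "spath E S T (z # w # c # es)"
            using z w wo zn dsp es unfolding esd
            by (auto simp: spath_def successively_append_iff successively_Cons)
          from longest[OF this] show False using ds esd by simp
        qed
      qed
    qed
    moreover have l4: "length cs + 1 < 2 * card (nbhd E W w)" using deg4[OF w(1)] cs by linarith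
    ultimately obtain us a b vs where s: "cs = us @ a # b # vs" "a \<in> nbhd E W w" "b \<in> nbhd E W w"
      using consecutive_in_listE[OF dcs(1)] finite_nbhd[OF finite_W] by metis
    have ab: "E w a" "E w b" "E a w" "E b w" using s sym by (auto simp: nbhd_def)
    have r1: "cyc (b # (vs @ us @ [a]))"
      using cyc_rotate[of "us @ [a]" "b # vs"] cs(1) s(1) by simp
    define gs where "gs = b # (vs @ us @ [a])"
    have gs: "distinct gs" "set gs = set cs" "successively E gs" "hd gs = b" "last gs = a" "length gs = length cs"
      using r1 s unfolding gs_def by (auto simp: cyc_def)
    have subS: "nbhd E W w \<subseteq> set gs \<inter> S" using sub nbhd_T[OF wT] gs by auto
    then have "card (nbhd E W w) \<le> card (set gs \<inter> S)" by (intro card_mono) auto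
    then have lg: "length gs + 1 < 2 * card (set gs \<inter> S)" using l4 gs by linarith
    \<comment> \<open>The cycle is reopened between the consecutive \<open>S\<close>-vertices
      \<open>x\<close> and \<open>y\<close>, which become the ends, while \<open>w\<close> is
      inserted between \<open>a\<close> and \<open>b\<close>.\<close>
    obtain us' x y vs' where t: "gs = us' @ x # y # vs'" "x \<in> set gs \<inter> S" "y \<in> set gs \<inter> S"
      by (rule consecutive_in_listE[of gs "set gs \<inter> S", OF gs(1) _ _ lg]) simp_all
    have "spath E S T ((y # vs') @ w # (us' @ [x]))"
    proof -
      have su: "successively E (y # vs')" "successively E (us' @ [x])"
        using gs(3) unfolding t(1) by (auto simp: successively_append_iff)
      have la: "last (y # vs') = a" "hd (us' @ [x]) = b"
        using gs(4,5) unfolding t(1) by (cases us'; auto)+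
      have "successively E (w # (us' @ [x]))"
        using ab la su by (simp only: successively_Cons) simp
      then have "successively E ((y # vs') @ w # (us' @ [x]))"
        using ab la su by (subst successively_append_iff) simp
      moreover have "distinct ((y # vs') @ w # (us' @ [x]))"
        using gs(1,2) wn unfolding t(1) by auto
      moreover have "set ((y # vs') @ w # (us' @ [x])) \<subseteq> W"
        using gs(2) dcs w unfolding t(1) by auto
      ultimately show ?thesis using t by (auto simp: spath_def)
    qed
    from longest[OF this] show False using gs(6) t(1) by simp
  qed
qed

lemma not_connected:
  assumes "7 \<le> card W"
  obtains A where "A \<subseteq> W" "A \<noteq> {}" "A \<noteq> W" "\<And>a b. a \<in> A \<Longrightarrow> b \<in> W - A \<Longrightarrow> \<not> E a b"
proof -
  have "W \<noteq> {}" using assms by auto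
  then obtain x where x: "x \<in> W" by blast
  have "S \<noteq> {}"
  proof
    assume S: "S = {}"
    then have "nbhd E W x = {}" using x nbhd_T[of x] by auto
    then show False using deg4[OF x] by simp
  qed
  then obtain s where s: "s \<in> S" by blast
  then have "spath E S T [s]" by (auto simp: spath_def)
  then obtain xs where xs: "spath E S T xs" "\<And>ys. spath E S T ys \<Longrightarrow> length ys \<le> length xs"
    using ex_has_greatest_nat[of "spath E S T" "[s]" length 7] spath_length by fastforce
  obtain cs where cs: "cyc cs" "set cs = set xs" "length cs = length xs" "5 \<le> length cs" "length cs \<le> 6"
    using longest_to_cyc[OF xs] by metis
  have cl: "\<not> E a b" if "a \<in> set cs" "b \<in> W - set cs" for a b
    using longest_cyc_closed[OF cs(1,4,5), of a b] xs(2) cs(3) that sym by auto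
  have "card (set cs) \<le> 6" using cs card_length[of cs] by linarith
  then have "set cs \<noteq> W" using assms by force
  moreover have "set cs \<subseteq> W" "set cs \<noteq> {}" using cs by (auto simp: cyc_def)
  ultimately show thesis using that[of "set cs"] cl by blast
qed

end

section \<open>Degree sums and bounds on the number of edges\<close>

lemma degsum_remove:
  assumes "finite W" "x \<in> W" "\<And>x y. E x y \<Longrightarrow> E y x" "\<And>x. \<not> E x x"
  shows "degsum E W = degsum E (W - {x}) + 2 * card (nbhd E (W - {x}) x)"
proof -
  let ?V = "W - {x}"
  have nx: "nbhd E W x = nbhd E ?V x" using assms(4) by (auto simp: nbhd_def)
  have "(\<Sum>y\<in>?V. card (nbhd E W y)) = (\<Sum>y\<in>?V. card (nbhd E ?V y) + (if E x y then 1 else 0))"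
  proof (rule sum.cong)
    fix y assume y: "y \<in> ?V"
    have "nbhd E W y = (if E x y then insert x (nbhd E ?V y) else nbhd E ?V y)"
      using assms by (auto simp: nbhd_def)
    moreover have "x \<notin> nbhd E ?V y" by (auto simp: nbhd_def)
    ultimately show "card (nbhd E W y) = card (nbhd E ?V y) + (if E x y then 1 else 0)"
      using assms(1) by simp
  qed simp
  also have "\<dots> = degsum E ?V + card (nbhd E ?V x)"
    using assms(1) by (simp add: degsum_def sum.distrib nbhd_def sum.If_cases Int_def)
  finally show ?thesis
    using sum.remove[OF assms(1,2), of "\<lambda>y. card (nbhd E W y)"] nx by (simp add: degsum_def)
qed

lemma degsum_empty [simp]: "degsum E {} = 0"
  by (simp add: degsum_def)

lemma even_degsum:
  assumes "\<And>x y. E x y \<Longrightarrow> E y x" "\<And>x. \<not> E x x"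
  shows "finite W \<Longrightarrow> even (degsum E W)"
proof (induction W rule: finite_induct)
  case (insert x F)
  then show ?case using degsum_remove[of "insert x F" x E] assms by simp
qed simp

lemma card_nbhd_less:
  assumes "finite W" "x \<in> W" "\<And>x. \<not> E x x"
  shows "card (nbhd E W x) \<le> card W - 1"
proof -
  have "nbhd E W x \<subseteq> W - {x}" using assms by (auto simp: nbhd_def)
  then show ?thesis using assms card_mono[of "W - {x}" "nbhd E W x"] by simp
qed

lemma degsum_le_complete:
  assumes "finite W" "\<And>x. \<not> E x x"
  shows "degsum E W \<le> card W * (card W - 1)"
  using sum_bounded_above[of W "\<lambda>x. card (nbhd E W x)" "card W - 1"] card_nbhd_less[OF assms(1)] assms(2)
  by (simp add: degsum_def)

lemma degsum_split:
  assumes "finite W" "A \<subseteq> W" "\<And>a b. a \<in> A \<Longrightarrow> b \<in> W - A \<Longrightarrow> \<not> E a b" "\<And>x y. E x y \<Longrightarrow> E y x"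
  shows "degsum E W = degsum E A + degsum E (W - A)"
proof -
  have "nbhd E W x = nbhd E A x" if "x \<in> A" for x
    using that assms by (auto simp: nbhd_def)
  moreover have "nbhd E W x = nbhd E (W - A) x" if "x \<in> W - A" for x
    using assms(3)[OF _ that] assms(4) by (auto simp: nbhd_def)
  ultimately show ?thesis
    using sum.subset_diff[OF assms(2,1), of "\<lambda>x. card (nbhd E W x)"] by (simp add: degsum_def)
qed

context split_graph
begin

lemma subgraph: "S' \<subseteq> S \<Longrightarrow> T' \<subseteq> T \<Longrightarrow> split_graph E S' T'"
  using finite_subset[OF _ finite_S] finite_subset[OF _ finite_T] disjoint
  by (intro split_graph.intro) (auto intro: sym simp: irrefl indep subset_eq)

lemma spath_mono: "spath E S' T' xs \<Longrightarrow> S' \<subseteq> S \<Longrightarrow> T' \<subseteq> T \<Longrightarrow> spath E S T xs"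
  by (auto simp: spath_def)

lemma low_degree_or_disconnected:
  assumes "\<And>xs. spath E S T xs \<Longrightarrow> length xs \<noteq> 7" "7 \<le> card W" "\<And>x. x \<in> W \<Longrightarrow> 4 \<le> card (nbhd E W x)"
  obtains A where "A \<subseteq> W" "A \<noteq> {}" "A \<noteq> W" "\<And>a b. a \<in> A \<Longrightarrow> b \<in> W - A \<Longrightarrow> \<not> E a b"
proof -
  interpret split_graph_core E S T
    using assms by unfold_locales auto
  show thesis by (rule not_connected[OF assms(2)]) (rule that)
qed

text \<open>With minimum degree four the graph would split, and both sides would contain a vertex
  together with four neighbours, hence at least ten vertices in total.\<close>

lemma ex_low_degree:
  assumes "\<And>xs. spath E S T xs \<Longrightarrow> length xs \<noteq> 7" "7 \<le> card W" "card W \<le> 9"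
  shows "\<exists>x\<in>W. card (nbhd E W x) \<le> 3"
proof (rule ccontr)
  assume *: "\<not> ?thesis"
  then have deg: "4 \<le> card (nbhd E W x)" if "x \<in> W" for x using that by force
  obtain A where A: "A \<subseteq> W" "A \<noteq> {}" "A \<noteq> W" "\<And>a b. a \<in> A \<Longrightarrow> b \<in> W - A \<Longrightarrow> \<not> E a b"
    using low_degree_or_disconnected[OF assms(1,2) deg] by blast
  have five: "5 \<le> card B" if B: "B \<subseteq> W" "B \<noteq> {}" "\<And>a b. a \<in> B \<Longrightarrow> b \<in> W - B \<Longrightarrow> \<not> E a b" for B
  proof -
    obtain a where a: "a \<in> B" using B by blast
    have "nbhd E W a \<subseteq> B - {a}" using B a irrefl by (auto simp: nbhd_def)
    moreover have fB: "finite B" using B finite_W finite_subset by blast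
    ultimately have "4 \<le> card (B - {a})"
      using deg[of a] a B card_mono[of "B - {a}" "nbhd E W a"] by fastforce
    then show ?thesis using a fB by (simp add: card_Diff_singleton)
  qed
  have "card (W - A) = card W - card A"
    using A(1) finite_W finite_subset by (intro card_Diff_subset) auto
  moreover have "5 \<le> card A" using five[of A] A by blast
  moreover have "5 \<le> card (W - A)" using five[of "W - A"] A sym by blast
  ultimately show False using assms by linarith
qed

end

text \<open>This is the bound of \<open>3q - 3\<close> edges. Up to six vertices it holds even for
  complete graphs. Beyond that, either a vertex of degree at most three is removed or the graph
  splits and both sides are bounded by induction.\<close>

lemma degsum_bound_weak:
  assumes "split_graph E S T" "\<And>xs. spath E S T xs \<Longrightarrow> length xs \<noteq> 7" "S \<union> T \<noteq> {}"
  shows "degsum E (S \<union> T) + 6 \<le> 6 * card (S \<union> T)"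
  using assms
proof (induction "card (S \<union> T)" arbitrary: S T rule: less_induct)
  case less
  interpret split_graph E S T by fact
  note no7 = less.prems(2)
  have sub: "degsum E A + 6 \<le> 6 * card A" if A: "A \<subset> W" "A \<noteq> {}" for A
  proof -
    have eq: "S \<inter> A \<union> T \<inter> A = A" using A by auto
    have "degsum E (S \<inter> A \<union> T \<inter> A) + 6 \<le> 6 * card (S \<inter> A \<union> T \<inter> A)"
    proof (rule less.hyps)
      show "card (S \<inter> A \<union> T \<inter> A) < card W"
        unfolding eq by (rule psubset_card_mono[OF finite_W A(1)])
      show "split_graph E (S \<inter> A) (T \<inter> A)" by (rule subgraph) auto
      show "length xs \<noteq> 7" if "spath E (S \<inter> A) (T \<inter> A) xs" for xs
        by (rule no7[OF spath_mono[OF that]]) auto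
      show "S \<inter> A \<union> T \<inter> A \<noteq> {}" using eq A by simp
    qed
    then show ?thesis by (simp only: eq)
  qed
  show ?case
  proof (cases "card W \<le> 6")
    case True
    have "card W \<noteq> 0" using less.prems(3) finite_W by auto
    then consider "card W = 1" | "card W = 2" | "card W = 3" | "card W = 4" | "card W = 5" | "card W = 6"
      using True by linarith
    then show ?thesis using degsum_le_complete[of W E] finite_W irrefl by cases simp_all
  next
    case False
    show ?thesis
    proof (cases "\<exists>x\<in>W. card (nbhd E W x) \<le> 3")
      case True
      then obtain x where x: "x \<in> W" "card (nbhd E W x) \<le> 3" by blast
      have "card (W - {x}) \<noteq> 0" using x False by simp
      then have "W - {x} \<noteq> {}" by force
      moreover have "W - {x} \<subset> W" using x by auto
      ultimately have "degsum E (W - {x}) + 6 \<le> 6 * card (W - {x})" using sub by blast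
      moreover have "card (nbhd E (W - {x}) x) \<le> 3"
        using x(2) card_mono[of "nbhd E W x" "nbhd E (W - {x}) x"] finite_W by (force simp: nbhd_def)
      ultimately show ?thesis
        using degsum_remove[of W x E, OF finite_W x(1) sym irrefl] x False by simp
    next
      case False
      then have deg: "\<And>x. x \<in> W \<Longrightarrow> 4 \<le> card (nbhd E W x)" by force
      obtain A where A: "A \<subseteq> W" "A \<noteq> {}" "A \<noteq> W" "\<And>a b. a \<in> A \<Longrightarrow> b \<in> W - A \<Longrightarrow> \<not> E a b"
        using low_degree_or_disconnected[OF no7 _ deg] \<open>\<not> card W \<le> 6\<close> by auto
      have "degsum E A + 6 \<le> 6 * card A" "degsum E (W - A) + 6 \<le> 6 * card (W - A)"
        using sub[of A] sub[of "W - A"] A by auto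
      moreover have "card W = card A + card (W - A)"
        using card_Diff_subset[OF finite_subset[OF A(1) finite_W] A(1)] card_mono[OF finite_W A(1)] by linarith
      ultimately show ?thesis using degsum_split[of W A E, OF finite_W A(1,4) sym] by simp
    qed
  qed
qed

text \<open>The propositional core of \<open>ham_path5\<close>. The \<open>b\<close>-variables are
  the edges at the starting vertex, the \<open>e\<close>-variables the edges among the other four
  vertices, and the \<open>s\<close>-variables membership in \<open>S\<close>. At most two of the
  ten edges are missing; the 24 disjuncts are the possible orders of the four vertices.\<close>

lemma ham_path_bool:
  fixes b1 b2 b3 b4 e12 e13 e14 e23 e24 e34 s1 s2 s3 s4 :: bool
  assumes "(if b1 then 1 else 0) + (if b2 then 1 else 0) + (if b3 then 1 else 0) + (if b4 then 1 else 0) + (if e12 then 1 else 0) + (if e13 then 1 else 0) + (if e14 then 1 else 0)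
      + (if e23 then 1 else 0) + (if e24 then 1 else 0) + (if e34 then 1 else 0) \<ge> (8 :: int)"
    and "e12 \<Longrightarrow> s1 \<or> s2" "e13 \<Longrightarrow> s1 \<or> s3" "e14 \<Longrightarrow> s1 \<or> s4"
    and "e23 \<Longrightarrow> s2 \<or> s3" "e24 \<Longrightarrow> s2 \<or> s4" "e34 \<Longrightarrow> s3 \<or> s4"
  shows "b1 \<and> e12 \<and> e23 \<and> e34 \<and> s4 \<or> b1 \<and> e12 \<and> e24 \<and> e34 \<and> s3 \<or>
    b1 \<and> e13 \<and> e23 \<and> e24 \<and> s4 \<or> b1 \<and> e13 \<and> e34 \<and> e24 \<and> s2 \<or>
    b1 \<and> e14 \<and> e24 \<and> e23 \<and> s3 \<or> b1 \<and> e14 \<and> e34 \<and> e23 \<and> s2 \<or>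
    b2 \<and> e12 \<and> e13 \<and> e34 \<and> s4 \<or> b2 \<and> e12 \<and> e14 \<and> e34 \<and> s3 \<or>
    b2 \<and> e23 \<and> e13 \<and> e14 \<and> s4 \<or> b2 \<and> e23 \<and> e34 \<and> e14 \<and> s1 \<or>
    b2 \<and> e24 \<and> e14 \<and> e13 \<and> s3 \<or> b2 \<and> e24 \<and> e34 \<and> e13 \<and> s1 \<or>
    b3 \<and> e13 \<and> e12 \<and> e24 \<and> s4 \<or> b3 \<and> e13 \<and> e14 \<and> e24 \<and> s2 \<or>
    b3 \<and> e23 \<and> e12 \<and> e14 \<and> s4 \<or> b3 \<and> e23 \<and> e24 \<and> e14 \<and> s1 \<or>
    b3 \<and> e34 \<and> e14 \<and> e12 \<and> s2 \<or> b3 \<and> e34 \<and> e24 \<and> e12 \<and> s1 \<or>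
    b4 \<and> e14 \<and> e12 \<and> e23 \<and> s3 \<or> b4 \<and> e14 \<and> e13 \<and> e23 \<and> s2 \<or>
    b4 \<and> e24 \<and> e12 \<and> e13 \<and> s3 \<or> b4 \<and> e24 \<and> e23 \<and> e13 \<and> s1 \<or>
    b4 \<and> e34 \<and> e13 \<and> e12 \<and> s2 \<or> b4 \<and> e34 \<and> e23 \<and> e12 \<and> s1"
  using assms by (smt (z3))

context split_graph
begin

lemma ham_path5:
  assumes "J \<subseteq> W" "card J = 5" "16 \<le> degsum E J" "b \<in> J"
  shows "\<exists>ys. distinct (b # ys) \<and> set (b # ys) = J \<and> successively E (b # ys) \<and> last (b # ys) \<in> S"
    (is ?thesis)
proof -
  have fJ: "finite J" using assms(1) finite_W finite_subset by blast
  have "card (J - {b}) = 4" using assms(2,4) fJ by simp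
  then obtain xs where xs: "set xs = J - {b}" "distinct xs" "length xs = 4"
    using finite_distinct_list[of "J - {b}"] fJ distinct_card by (metis finite_Diff)
  then obtain c1 c2 c3 c4 where c: "xs = [c1, c2, c3, c4]"
    by (auto simp: numeral_eq_Suc length_Suc_conv)
  have J: "J = {b, c1, c2, c3, c4}" and d: "distinct [b, c1, c2, c3, c4]"
    using xs c assms(4) by auto
  have card_nb: "int (card (nbhd E J x)) = (\<Sum>y\<in>J. if E x y then 1 else 0)" for x
    using fJ by (simp add: nbhd_def sum.If_cases Int_def)
  define s :: int where "s = (if E b c1 then 1 else 0) + (if E b c2 then 1 else 0) + (if E b c3 then 1 else 0)
      + (if E b c4 then 1 else 0) + (if E c1 c2 then 1 else 0) + (if E c1 c3 then 1 else 0)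
      + (if E c1 c4 then 1 else 0) + (if E c2 c3 then 1 else 0) + (if E c2 c4 then 1 else 0)
      + (if E c3 c4 then 1 else 0)"
  have "int (degsum E J) = (\<Sum>x\<in>J. \<Sum>y\<in>J. if E x y then 1 else 0)"
    by (simp add: degsum_def card_nb)
  also have "\<dots> = 2 * s"
    unfolding s_def
    using d irrefl E_commute[of c1 b] E_commute[of c2 b] E_commute[of c3 b] E_commute[of c4 b]
      E_commute[of c2 c1] E_commute[of c3 c1] E_commute[of c4 c1] E_commute[of c3 c2]
      E_commute[of c4 c2] E_commute[of c4 c3]
    by (simp add: J)
  finally have "s \<ge> 8"
    using assms(3) by linarith
  moreover have "c1 \<in> S \<or> c1 \<in> T" "c2 \<in> S \<or> c2 \<in> T" "c3 \<in> S \<or> c3 \<in> T" "c4 \<in> S \<or> c4 \<in> T"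
    using assms(1) J by auto
  ultimately have i: "E c1 c2 \<Longrightarrow> c1 \<in> S \<or> c2 \<in> S" "E c1 c3 \<Longrightarrow> c1 \<in> S \<or> c3 \<in> S"
    "E c1 c4 \<Longrightarrow> c1 \<in> S \<or> c4 \<in> S" "E c2 c3 \<Longrightarrow> c2 \<in> S \<or> c3 \<in> S"
    "E c2 c4 \<Longrightarrow> c2 \<in> S \<or> c4 \<in> S" "E c3 c4 \<Longrightarrow> c3 \<in> S \<or> c4 \<in> S" and s8: "s \<ge> 8"
    using indep by blast+
  note disj = ham_path_bool[OF s8[unfolded s_def] i]
  \<comment> \<open>One order of the remaining four vertices, turned into the required path; all 24
    orders are instantiated at the end.\<close>
  have W: "E b w \<and> E w x \<and> E x y \<and> E y z \<and> z \<in> S \<longrightarrow> ?thesis"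
    if "mset [w, x, y, z] = mset xs" for w x y z
  proof -
    have "set [w, x, y, z] = set xs" "distinct [w, x, y, z]"
      using mset_eq_setD[OF that] mset_eq_imp_distinct_iff[OF that] xs(2) by blast+
    then show ?thesis
      using \<open>b \<in> J\<close> xs(1) by (intro impI exI[of _ "[w, x, y, z]"]) auto
  qed
  have c': "E c2 c1 = E c1 c2" "E c3 c1 = E c1 c3" "E c4 c1 = E c1 c4" "E c3 c2 = E c2 c3"
    "E c4 c2 = E c2 c4" "E c4 c3 = E c3 c4"
    using E_commute by blast+
  show ?thesis
    using disj
      W[of c1 c2 c3 c4] W[of c1 c2 c4 c3] W[of c1 c3 c2 c4] W[of c1 c3 c4 c2]
      W[of c1 c4 c2 c3] W[of c1 c4 c3 c2] W[of c2 c1 c3 c4] W[of c2 c1 c4 c3]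
      W[of c2 c3 c1 c4] W[of c2 c3 c4 c1] W[of c2 c4 c1 c3] W[of c2 c4 c3 c1]
      W[of c3 c1 c2 c4] W[of c3 c1 c4 c2] W[of c3 c2 c1 c4] W[of c3 c2 c4 c1]
      W[of c3 c4 c1 c2] W[of c3 c4 c2 c1] W[of c4 c1 c2 c3] W[of c4 c1 c3 c2]
      W[of c4 c2 c1 c3] W[of c4 c2 c3 c1] W[of c4 c3 c1 c2] W[of c4 c3 c2 c1]
    unfolding c' c by (simp only: mset.simps add_mset_commute simp_thms) argo
qed

lemma degsum_remove_le:
  assumes "A \<subseteq> W" "x \<in> A"
  shows "degsum E A \<le> degsum E (A - {x}) + 2 * (card A - 1)"
proof -
  have fA: "finite A" using assms finite_W finite_subset by blast
  have "card (nbhd E (A - {x}) x) \<le> card (A - {x})"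
    using fA by (intro card_mono nbhd_subset) simp
  then show ?thesis
    using degsum_remove[of A x E, OF fA assms(2) sym irrefl] fA assms(2) by simp
qed

text \<open>At most two edges are missing in \<open>K\<close>. Without \<open>a\<close>, which
  carries at most five edges, eight remain on five vertices, so \<open>ham_path5\<close> starts at a
  neighbour \<open>b\<close> of \<open>a\<close> and ends in \<open>S\<close>. Putting
  \<open>s\<close> and \<open>a\<close> in front makes seven vertices.\<close>

lemma dense6_S:
  assumes K: "K \<subseteq> W" "card K = 6" "26 \<le> degsum E K" and s: "s \<in> S" "s \<notin> K" and a: "a \<in> K" "E s a"
  shows "\<exists>xs. spath E S T xs \<and> length xs = 7"
proof -
  have fK: "finite K" using K finite_W finite_subset by blast
  have c5: "card (K - {a}) = 5" using K a fK by simp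
  have d5: "16 \<le> degsum E (K - {a})" using degsum_remove_le[OF K(1) a(1)] K by simp
  have "degsum E (K - {a}) \<le> 20"
    using degsum_le_complete[of "K - {a}" E] fK irrefl c5 by simp
  then have "card (nbhd E (K - {a}) a) \<noteq> 0"
    using degsum_remove[of K a E, OF fK a(1) sym irrefl] K by linarith
  then have "nbhd E (K - {a}) a \<noteq> {}" by auto
  then obtain b where b: "b \<in> K - {a}" "E a b" by (auto simp: nbhd_def)
  have "K - {a} \<subseteq> W" using K by blast
  then obtain ys where ys: "distinct (b # ys)" "set (b # ys) = K - {a}" "successively E (b # ys)"
      "last (b # ys) \<in> S"
    using ham_path5[OF _ c5 d5 b(1)] by metis
  have "length (b # ys) = 5" using ys distinct_card c5 by metis
  moreover have "spath E S T (s # a # b # ys)"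
    using ys s a b K by (auto simp: spath_def)
  ultimately show ?thesis by (intro exI[of _ "s # a # b # ys"]) simp
qed

text \<open>The vertex \<open>t\<close> may not be an end, so it is entered from \<open>a\<close>,
  which lies in \<open>S\<close> by independence, and left towards \<open>b\<close>, where the path
  through the other five vertices of \<open>K\<close> begins.\<close>

lemma dense6_T:
  assumes K: "K \<subseteq> W" "card K = 6" "26 \<le> degsum E K" and t: "t \<in> T" "t \<notin> K"
    and a: "a \<in> K" "E t a" and b: "b \<in> K" "E t b" "a \<noteq> b"
  shows "\<exists>xs. spath E S T xs \<and> length xs = 7"
proof -
  have fK: "finite K" using K finite_W finite_subset by blast
  have c5: "card (K - {a}) = 5" using K a fK by simp
  have d5: "16 \<le> degsum E (K - {a})" using degsum_remove_le[OF K(1) a(1)] K by simp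
  have aS: "a \<in> S" using a K t indep by blast
  have "K - {a} \<subseteq> W" "b \<in> K - {a}" using K b by auto
  then obtain ys where ys: "distinct (b # ys)" "set (b # ys) = K - {a}" "successively E (b # ys)"
      "last (b # ys) \<in> S"
    using ham_path5[OF _ c5 d5] by metis
  have "length (b # ys) = 5" using ys distinct_card c5 by metis
  moreover have "spath E S T (a # t # b # ys)"
    using ys t a b K aS sym by (auto simp: spath_def)
  ultimately show ?thesis by (intro exI[of _ "a # t # b # ys"]) simp
qed

end

text \<open>
  The only graph on seven vertices that exceeds the bound \<open>3q - 6\<close> on the number of edges is
  \<open>K\<^sub>6\<close> with a pendant vertex in \<open>T\<close>, and it does not extend to eight vertices.
\<close>

lemma degsum_bound8:
  assumes "split_graph E S T" "\<And>xs. spath E S T xs \<Longrightarrow> length xs \<noteq> 7" "card (S \<union> T) = 8"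
  shows "degsum E (S \<union> T) \<le> 36"
proof (rule ccontr)
  interpret split_graph E S T by fact
  note no7 = assms(2)
  assume big: "\<not> ?thesis"
  have "even (degsum E W)" by (rule even_degsum) (use sym irrefl finite_W in auto)
  then obtain k where k: "degsum E W = 2 * k" by (rule evenE)
  \<comment> \<open>Parity lifts the count from above 18 to 19 edges. Removing two vertices of
    degree at most three then leaves six vertices with at least 13 edges.\<close>
  with big have "19 \<le> k" by linarith
  with k have D8: "38 \<le> degsum E W" by linarith
  obtain x where x: "x \<in> W" "card (nbhd E W x) \<le> 3"
    using ex_low_degree[OF no7] assms(3) by auto
  let ?V = "W - {x}"
  have remx: "degsum E W = degsum E ?V + 2 * card (nbhd E ?V x)"
    by (rule degsum_remove[of W x E, OF finite_W x(1) sym irrefl])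
  have "card (nbhd E ?V x) \<le> card (nbhd E W x)"
    using finite_W by (intro card_mono) (auto simp: nbhd_def)
  then have x3: "card (nbhd E ?V x) \<le> 3" using x by linarith
  have V7: "card ?V = 7" using assms(3) x finite_W by simp
  have D7: "32 \<le> degsum E ?V" using D8 remx x3 by linarith
  interpret V: split_graph E "S - {x}" "T - {x}" by (rule subgraph) auto
  have Veq: "S - {x} \<union> (T - {x}) = ?V" by auto
  have noV: "length xs \<noteq> 7" if "spath E (S - {x}) (T - {x}) xs" for xs
    by (rule no7[OF spath_mono[OF that]]) auto
  obtain y where y: "y \<in> ?V" "card (nbhd E ?V y) \<le> 3"
    using V.ex_low_degree[OF noV] V7 unfolding Veq by auto
  let ?K = "?V - {y}"
  have fV: "finite ?V" using finite_W by simp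
  have remy: "degsum E ?V = degsum E ?K + 2 * card (nbhd E ?K y)"
    by (rule degsum_remove[of ?V y E, OF fV y(1) sym irrefl])
  have "card (nbhd E ?K y) \<le> card (nbhd E ?V y)"
    using fV by (intro card_mono) (auto simp: nbhd_def)
  then have y3: "card (nbhd E ?K y) \<le> 3" using y by linarith
  have K: "?K \<subseteq> W" "card ?K = 6" "26 \<le> degsum E ?K"
    using V7 y fV D7 remy y3 by auto
  have A: "\<not> E s a" if "s \<in> S" "s \<notin> ?K" "a \<in> ?K" for s a
    using dense6_S[OF K that] no7 by blast
  have B: "card (nbhd E ?K t) \<le> 1" if "t \<in> T" "t \<notin> ?K" for t
  proof (rule ccontr)
    assume "\<not> ?thesis"
    then obtain a b where "a \<in> nbhd E ?K t" "b \<in> nbhd E ?K t" "a \<noteq> b"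
      by (metis card_le_Suc0_iff_eq One_nat_def finite_nbhd fV finite_Diff)
    then show False using dense6_T[OF K that, of a b] no7 by (auto simp: nbhd_def)
  qed
  have "degsum E ?K \<le> 30" using degsum_le_complete[of ?K E] fV irrefl K by simp
  then have ne: "nbhd E ?K y \<noteq> {}" using D7 remy by auto
  then have "y \<notin> S" using A[of y] by (auto simp: nbhd_def)
  then have yT: "y \<in> T" using y by auto
  then have "degsum E ?V \<le> 32" using B[of y] remy \<open>degsum E ?K \<le> 30\<close> by simp
  \<comment> \<open>Without \<open>x\<close> there are at most 15 + 1 edges, so \<open>x\<close>
    must carry three. In \<open>S\<close> it can only see \<open>y\<close>; in \<open>T\<close> it
    cannot see \<open>y\<close> and sees at most one vertex of the dense six.\<close>
  then have x3': "3 \<le> card (nbhd E ?V x)" using D8 remx by linarith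
  show False
  proof (cases "x \<in> S")
    case True
    then have "nbhd E ?V x \<subseteq> {y}" using A[of x] by (auto simp: nbhd_def)
    then have "card (nbhd E ?V x) \<le> 1" using card_mono[of "{y}"] by simp
    then show False using x3' by simp
  next
    case False
    then have xT: "x \<in> T" using x by auto
    then have "nbhd E ?V x = nbhd E ?K x" using yT indep by (auto simp: nbhd_def)
    then show False using B[of x] xT x3' by simp
  qed
qed

text \<open>The induction of the weak bound, started at eight vertices. If the graph splits, the
  weak bound on each side saves 6, which adds up to the required 12 whatever the sizes of the
  sides.\<close>

lemma degsum_bound:
  assumes "split_graph E S T" "\<And>xs. spath E S T xs \<Longrightarrow> length xs \<noteq> 7" "8 \<le> card (S \<union> T)"
  shows "degsum E (S \<union> T) + 12 \<le> 6 * card (S \<union> T)"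
  using assms
proof (induction "card (S \<union> T)" arbitrary: S T rule: less_induct)
  case less
  interpret split_graph E S T by fact
  note no7 = less.prems(2)
  show ?case
  proof (cases "card W = 8")
    case True
    then show ?thesis using degsum_bound8[OF less.prems(1,2)] by simp
  next
    case False
    then have c9: "9 \<le> card W" using less.prems by simp
    show ?thesis
    proof (cases "\<exists>x\<in>W. card (nbhd E W x) \<le> 3")
      case True
      then obtain x where x: "x \<in> W" "card (nbhd E W x) \<le> 3" by blast
      have cx: "card (W - {x}) = card W - 1" using x by simp
      have eq: "S - {x} \<union> (T - {x}) = W - {x}" by auto
      have "degsum E (S - {x} \<union> (T - {x})) + 12 \<le> 6 * card (S - {x} \<union> (T - {x}))"
      proof (rule less.hyps)
        show "card (S - {x} \<union> (T - {x})) < card W" unfolding eq using cx c9 by simp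
        show "split_graph E (S - {x}) (T - {x})" by (rule subgraph) auto
        show "length xs \<noteq> 7" if "spath E (S - {x}) (T - {x}) xs" for xs
          by (rule no7[OF spath_mono[OF that]]) auto
        show "8 \<le> card (S - {x} \<union> (T - {x}))" unfolding eq using cx c9 by simp
      qed
      moreover have "card (nbhd E (W - {x}) x) \<le> card (nbhd E W x)"
        using finite_W by (intro card_mono) (auto simp: nbhd_def)
      ultimately show ?thesis
        using degsum_remove[of W x E, OF finite_W x(1) sym irrefl] x cx c9 by (simp add: eq)
    next
      case False
      then have deg: "\<And>x. x \<in> W \<Longrightarrow> 4 \<le> card (nbhd E W x)" by force
      have c7: "7 \<le> card W" using c9 by simp
      obtain A where A: "A \<subseteq> W" "A \<noteq> {}" "A \<noteq> W" "\<And>a b. a \<in> A \<Longrightarrow> b \<in> W - A \<Longrightarrow> \<not> E a b"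
        using low_degree_or_disconnected[OF no7 c7 deg] by blast
      have weak: "degsum E B + 6 \<le> 6 * card B" if B: "B \<subseteq> W" "B \<noteq> {}" for B
      proof -
        have eq: "S \<inter> B \<union> T \<inter> B = B" using B by auto
        have "degsum E (S \<inter> B \<union> T \<inter> B) + 6 \<le> 6 * card (S \<inter> B \<union> T \<inter> B)"
        proof (rule degsum_bound_weak)
          show "split_graph E (S \<inter> B) (T \<inter> B)" by (rule subgraph) auto
          show "length xs \<noteq> 7" if "spath E (S \<inter> B) (T \<inter> B) xs" for xs
            by (rule no7[OF spath_mono[OF that]]) auto
          show "S \<inter> B \<union> T \<inter> B \<noteq> {}" using eq B by simp
        qed
        then show ?thesis by (simp only: eq)
      qed
      have "card W = card A + card (W - A)"
        using card_Diff_subset[OF finite_subset[OF A(1) finite_W] A(1)] card_mono[OF finite_W A(1)]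
        by linarith
      moreover have "W - A \<subseteq> W" "W - A \<noteq> {}" using A by auto
      ultimately show ?thesis
        using degsum_split[of W A E, OF finite_W A(1,4) sym] weak[of A] weak[of "W - A"] A by simp
    qed
  qed
qed

section \<open>Hosts of large minimum degree\<close>

definition wheel8 :: "('a \<Rightarrow> 'a \<Rightarrow> bool) \<Rightarrow> 'a set \<Rightarrow> bool" where
  "wheel8 E V \<longleftrightarrow> (\<exists>h xs. length xs = 8 \<and> distinct (h # xs) \<and> set (h # xs) \<subseteq> V \<and>
     (\<forall>x\<in>set xs. E h x) \<and> successively E xs \<and> E (last xs) (hd xs))"

lemma distinct_representatives4:
  fixes A B C D :: "'a set"
  assumes "4 \<le> card A" "4 \<le> card B" "4 \<le> card C" "4 \<le> card D"
  obtains a b c d where "a \<in> A" "b \<in> B" "c \<in> C" "d \<in> D" "distinct [a, b, c, d]"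
proof -
  have pick: "\<exists>x\<in>X. x \<notin> set xs" if "4 \<le> card X" "length xs < 4" for X :: "'a set" and xs
  proof (rule ccontr)
    assume "\<not> ?thesis"
    then have "card X \<le> card (set xs)" by (intro card_mono) auto
    then show False using that card_length[of xs] by linarith
  qed
  obtain a where a: "a \<in> A" using pick[of A "[]"] assms by auto
  obtain b where b: "b \<in> B" "b \<notin> set [a]" using pick[of B "[a]"] assms by auto
  obtain c where c: "c \<in> C" "c \<notin> set [a, b]" using pick[of C "[a, b]"] assms by auto
  obtain d where d: "d \<in> D" "d \<notin> set [a, b, c]" using pick[of D "[a, b, c]"] assms by auto
  show thesis using that[of a b c d] a b c d by auto
qed

lemma obtain_distinct4:
  assumes "4 \<le> card A"
  obtains a b c d where "{a, b, c, d} \<subseteq> A" "distinct [a, b, c, d]"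
  using distinct_representatives4[OF assms assms assms assms] by (metis empty_subsetI insert_subset)

lemma obtain_distinct2:
  assumes "2 \<le> card A"
  obtains a b where "a \<in> A" "b \<in> A" "a \<noteq> b"
  using assms by (metis card_le_Suc0_iff_eq One_nat_def Suc_1 card.infinite not_less_eq_eq zero_le)

lemma card_Un4_le: "card (A \<union> B \<union> C \<union> D) \<le> card A + card B + card C + card D"
  using card_Un_le[of "A \<union> B \<union> C" D] card_Un_le[of "A \<union> B" C] card_Un_le[of A B] by linarith

lemma card_Un5_le: "card (A \<union> B \<union> C \<union> D \<union> F) \<le> card A + card B + card C + card D + card F"
  using card_Un_le[of "A \<union> B \<union> C \<union> D" F] card_Un4_le[of A B C D] by linarith

locale host =
  fixes E :: "'a \<Rightarrow> 'a \<Rightarrow> bool" and V :: "'a set"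
  assumes finite_V: "finite V" and sym: "\<And>x y. E x y \<Longrightarrow> E y x" and irrefl: "\<And>x. \<not> E x x"
    and no_wheel: "\<not> wheel8 E V"
begin

lemma no_wheel_list:
  assumes "distinct [h, a, b, c, d, e, f, g, i]" "{h, a, b, c, d, e, f, g, i} \<subseteq> V"
    "E h a" "E h b" "E h c" "E h d" "E h e" "E h f" "E h g" "E h i"
    "E a b" "E b c" "E c d" "E d e" "E e f" "E f g" "E g i" "E i a"
  shows False
proof -
  have "wheel8 E V"
    unfolding wheel8_def
    by (rule exI[of _ h], rule exI[of _ "[a, b, c, d, e, f, g, i]"]) (use assms in simp)
  then show False using no_wheel by contradiction
qed

text \<open>Discarding the edges inside \<open>T\<close> makes \<open>T\<close> independent, as
  \<open>split_graph\<close> demands, while paths of the thinned graph remain paths of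
  \<open>E\<close>.\<close>

definition cut :: "'a set \<Rightarrow> 'a \<Rightarrow> 'a \<Rightarrow> bool" where
  "cut T x y \<longleftrightarrow> E x y \<and> \<not> (x \<in> T \<and> y \<in> T)"

text \<open>A 7-vertex path with both ends in \<open>N(u)\<close> closes up through \<open>u\<close> to a rim for the hub \<open>h\<close>.\<close>

lemma hub_no7:
  assumes "h \<in> V" "u \<in> V" "E h u" "S \<subseteq> {x \<in> V. E h x \<and> E u x}" "T \<subseteq> {x \<in> V. E h x}"
    "u \<notin> T" "S \<inter> T = {}"
  shows "split_graph (cut T) S T" "spath (cut T) S T xs \<Longrightarrow> length xs \<noteq> 7"
proof -
  show "split_graph (cut T) S T"
  proof
    show "finite S" "finite T" using assms finite_V by (auto intro: finite_subset)
  qed (use assms in \<open>auto simp: cut_def irrefl intro: sym\<close>)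
  show "length xs \<noteq> 7" if P: "spath (cut T) S T xs"
  proof
    assume len: "length xs = 7"
    have "successively E xs"
      using P by (auto simp: spath_def cut_def intro: successively_mono)
    moreover have "u \<notin> S" "h \<notin> S" "h \<notin> T" "h \<noteq> u"
      using assms irrefl by auto
    moreover have P': "xs \<noteq> []" "distinct xs" "set xs \<subseteq> S \<union> T" "hd xs \<in> S" "last xs \<in> S"
      using P by (auto simp: spath_def)
    moreover have "E u (hd xs)" "E (last xs) u"
      using P' assms(4) by (auto intro: sym)
    moreover have "\<forall>x\<in>set xs. E h x" "set xs \<subseteq> V"
      using P' assms(4,5) by blast+
    ultimately have "wheel8 E V"
      unfolding wheel8_def
      using len assms(1,2,3,6)
      by (intro exI[of _ h] exI[of _ "u # xs"]) (auto simp: successively_Cons)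
    then show False using no_wheel by contradiction
  qed
qed

text \<open>Double counting: an edge between \<open>S\<close> and \<open>T\<close> contributes once
  at each end, and both contributions are charged to its end in \<open>S\<close>.\<close>

lemma degsum_cut:
  assumes "split_graph (cut T) S T"
  shows "degsum (cut T) (S \<union> T) = (\<Sum>z\<in>S. card (nbhd E S z) + 2 * card (nbhd E T z))"
proof -
  interpret sg: split_graph "cut T" S T by fact
  have S: "card (nbhd (cut T) (S \<union> T) z) = card (nbhd E S z) + card (nbhd E T z)" if "z \<in> S" for z
  proof -
    have "z \<notin> T" using that sg.disjoint by auto
    then have "nbhd (cut T) (S \<union> T) z = nbhd E S z \<union> nbhd E T z" by (auto simp: nbhd_def cut_def)
    moreover have "nbhd E S z \<inter> nbhd E T z = {}" using sg.disjoint by (auto simp: nbhd_def)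
    ultimately show ?thesis using sg.finite_S sg.finite_T by (simp add: card_Un_disjoint)
  qed
  have T: "card (nbhd (cut T) (S \<union> T) t) = (\<Sum>z\<in>S. if E z t then 1 else 0)" if "t \<in> T" for t
  proof -
    have "nbhd (cut T) (S \<union> T) t = {z \<in> S. E z t}"
      using that sg.disjoint by (auto simp: nbhd_def cut_def intro: sym)
    then show ?thesis using sg.finite_S by (simp add: sum.If_cases Int_def)
  qed
  have "(\<Sum>t\<in>T. card (nbhd (cut T) (S \<union> T) t)) = (\<Sum>t\<in>T. \<Sum>z\<in>S. if E z t then 1 else 0)"
    using T by simp
  also have "\<dots> = (\<Sum>z\<in>S. \<Sum>t\<in>T. if E z t then 1 else 0)" by (rule sum.swap)
  also have "\<dots> = (\<Sum>z\<in>S. card (nbhd E T z))"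
    using sg.finite_T by (simp add: nbhd_def sum.If_cases Int_def)
  finally have "(\<Sum>t\<in>T. card (nbhd (cut T) (S \<union> T) t)) = (\<Sum>z\<in>S. card (nbhd E T z))" .
  moreover have "(\<Sum>z\<in>S. card (nbhd (cut T) (S \<union> T) z)) = (\<Sum>z\<in>S. card (nbhd E S z) + card (nbhd E T z))"
    using S by (rule sum.cong[OF refl])
  ultimately show ?thesis
    unfolding degsum_def sum.union_disjoint[OF sg.finite_S sg.finite_T sg.disjoint]
    by (simp add: sum.distrib flip: sum_distrib_left)
qed

lemma hub_sum_bound:
  assumes "h \<in> V" "u \<in> V" "E h u" "S \<subseteq> {x \<in> V. E h x \<and> E u x}" "T \<subseteq> {x \<in> V. E h x}"
    "u \<notin> T" "S \<inter> T = {}" "8 \<le> card S + card T"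
  shows "(\<Sum>z\<in>S. card (nbhd E S z) + 2 * card (nbhd E T z)) + 12 \<le> 6 * (card S + card T)"
proof -
  note h = hub_no7[OF assms(1-7)]
  have "card (S \<union> T) = card S + card T"
    using assms finite_V by (intro card_Un_disjoint) (auto intro: finite_subset)
  then show ?thesis
    using degsum_bound[OF h] degsum_cut[OF h(1)] assms(8) by simp
qed

end

section \<open>Hosts of minimum degree n + 3 and the degrees inside M\<close>

locale dense_host = host +
  fixes n :: nat and v :: 'a and M :: "'a set"
  assumes n5: "5 \<le> n" and card_V: "card V = 2 * n + 1"
    and degree: "\<And>x. x \<in> V \<Longrightarrow> n + 3 \<le> card (nbhd E V x)"
    and v: "v \<in> V" and M: "M \<subseteq> nbhd E V v" and card_M: "card M = n + 3"
begin

definition "B = V - M"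

abbreviation d :: "'a \<Rightarrow> nat" where "d x \<equiv> card (nbhd E M x)"

lemma M_V: "M \<subseteq> V" and vM: "x \<in> M \<Longrightarrow> E v x" and v_M: "v \<notin> M"
  using M irrefl by (auto simp: nbhd_def)

lemma finite_M: "finite M" and finite_B: "finite B"
  using finite_subset[OF M_V finite_V] finite_V by (simp_all add: B_def)

lemma v_B: "v \<in> B"
  using v v_M by (simp add: B_def)

lemma card_B: "card B = n - 2"
  using card_V card_M M_V finite_M by (simp add: B_def card_Diff_subset)

lemma degree_split: "card (nbhd E V x) = d x + card (nbhd E B x)"
proof -
  have "nbhd E V x = nbhd E M x \<union> nbhd E B x" "nbhd E M x \<inter> nbhd E B x = {}"
    using M_V by (auto simp: nbhd_def B_def)
  then show ?thesis using finite_M finite_B by (simp add: card_Un_disjoint)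
qed

lemma card_nbhd_B: "x \<in> V \<Longrightarrow> n + 3 \<le> d x + card (nbhd E B x)"
  using degree[of x] degree_split by simp

lemma d_ge5: "x \<in> V \<Longrightarrow> 5 \<le> d x"
  using card_nbhd_B[of x] card_mono[OF finite_B nbhd_subset[of E B x]] card_B n5 by linarith

lemma d_le: "x \<in> M \<Longrightarrow> d x \<le> n + 2"
  using card_nbhd_less[of M x E] finite_M irrefl card_M by simp

text \<open>The adjacent vertices \<open>u\<close> and \<open>v\<close> exchange roles: first
  \<open>v\<close> is the hub and \<open>u\<close> closes the rim, then conversely. Both rounds use
  the same \<open>S\<close>, but \<open>T\<close> lies in \<open>M\<close> and \<open>T'\<close> in
  \<open>B\<close>, so together they account for nearly all neighbours of a vertex of
  \<open>S\<close>.\<close>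

lemma degree_dichotomy:
  assumes u: "u \<in> M" and n6: "6 \<le> n"
  shows "d u \<le> 6 \<or> n \<le> d u"
proof -
  define S where "S = nbhd E M u"
  define T where "T = M - S - {u}"
  have uV: "u \<in> V" using u M_V by blast
  have fS: "finite S" using finite_M by (simp add: S_def)
  have uS: "u \<notin> S" using irrefl by (auto simp: S_def nbhd_def)
  have SM: "S \<subseteq> M" by (simp add: S_def nbhd_subset)
  have cS: "card S = d u" by (simp add: S_def)
  have cT: "card T = n + 2 - d u"
  proof -
    have "card (M - S) = n + 3 - d u"
      using card_Diff_subset[OF fS SM] card_M cS by simp
    then show ?thesis using u uS finite_M by (simp add: T_def)
  qed
  have d: "5 \<le> d u" "d u \<le> n + 2" using d_ge5[OF uV] d_le[OF u] by auto
  \<comment> \<open>\<open>T'\<close> is to have the size of \<open>T\<close>, so that both rounds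
    concern \<open>n + 2\<close> vertices. It avoids \<open>v\<close>, the closing vertex of the
    second round.\<close>
  have "n + 2 - d u \<le> card (nbhd E B u - {v})"
  proof -
    have "v \<in> nbhd E B u" using v_B sym[OF vM[OF u]] by (simp add: nbhd_def)
    then have "card (nbhd E B u - {v}) = card (nbhd E B u) - 1" by simp
    then show ?thesis using card_nbhd_B[OF uV] by linarith
  qed
  then obtain T' where T': "T' \<subseteq> nbhd E B u - {v}" "card T' = n + 2 - d u"
    by (meson obtain_subset_with_card_n)
  define R where "R = B - {v} - T'"
  have T'B: "T' \<subseteq> B - {v}" using T' nbhd_subset by fastforce
  have "card (B - {v}) = n - 3" using v_B finite_B card_B by simp
  then have cR: "card R = d u - 5"
    using T'B T'(2) finite_B d n6 by (simp add: R_def card_Diff_subset finite_subset)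
  have fT: "finite T" and fR: "finite R" using finite_M finite_B by (simp_all add: T_def R_def)
  have fT': "finite T'" using T'B finite_B by (meson finite_Diff finite_subset)
  have 1: "(\<Sum>z\<in>S. card (nbhd E S z) + 2 * card (nbhd E T z)) + 12 \<le> 6 * (card S + card T)"
  proof (rule hub_sum_bound[OF v uV vM[OF u]])
    show "S \<subseteq> {x \<in> V. E v x \<and> E u x}" using SM M_V vM by (auto simp: S_def nbhd_def)
    show "T \<subseteq> {x \<in> V. E v x}" using M_V vM by (auto simp: T_def)
    show "8 \<le> card S + card T" using cS cT d n6 by simp
  qed (auto simp: T_def)
  have 2: "(\<Sum>z\<in>S. card (nbhd E S z) + 2 * card (nbhd E T' z)) + 12 \<le> 6 * (card S + card T')"
  proof (rule hub_sum_bound[OF uV v sym[OF vM[OF u]]])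
    show "S \<subseteq> {x \<in> V. E u x \<and> E v x}" using SM M_V vM by (auto simp: S_def nbhd_def)
    show "T' \<subseteq> {x \<in> V. E u x}" using T' by (auto simp: nbhd_def B_def)
    show "8 \<le> card S + card T'" using cS T' d n6 by simp
    show "S \<inter> T' = {}" using SM T'B by (auto simp: B_def)
  qed (use T' in auto)
  \<comment> \<open>Only \<open>u\<close>, \<open>v\<close> and the \<open>d u - 5\<close> vertices
    of \<open>R\<close> are left out by both rounds, and \<open>z\<close> has degree at least
    \<open>n + 3\<close>.\<close>
  have z: "n + 6 \<le> card (nbhd E S z) + card (nbhd E T z) + card (nbhd E T' z) + d u" if "z \<in> S" for z
  proof -
    have "nbhd E V z \<subseteq> {u, v} \<union> nbhd E S z \<union> nbhd E T z \<union> nbhd E T' z \<union> R"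
      by (auto simp: nbhd_def T_def R_def B_def)
    then have "card (nbhd E V z) \<le> card ({u, v} \<union> nbhd E S z \<union> nbhd E T z \<union> nbhd E T' z \<union> R)"
      using fS fT fT' fR by (intro card_mono) simp_all
    also have "\<dots> \<le> card {u, v} + card (nbhd E S z) + card (nbhd E T z) + card (nbhd E T' z) + card R"
      by (rule card_Un5_le)
    also have "card {u, v} \<le> 2" by (simp add: card_insert_if)
    finally have "card (nbhd E V z) \<le> 2 + card (nbhd E S z) + card (nbhd E T z) + card (nbhd E T' z) + card R"
      by simp
    moreover have "z \<in> V" using that SM M_V by blast
    ultimately show ?thesis
      using degree[of z] cR d by linarith
  qed
  have "card S * (n + 6) \<le> (\<Sum>z\<in>S. card (nbhd E S z) + card (nbhd E T z) + card (nbhd E T' z) + d u)"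
    using sum_bounded_below[of S "n + 6"] z by simp
  then have "d u * (n + 6) \<le> (\<Sum>z\<in>S. card (nbhd E S z)) + (\<Sum>z\<in>S. card (nbhd E T z))
      + (\<Sum>z\<in>S. card (nbhd E T' z)) + d u * d u"
    by (simp add: sum.distrib cS)
  moreover have "(\<Sum>z\<in>S. card (nbhd E S z)) + 2 * (\<Sum>z\<in>S. card (nbhd E T z)) + 12 \<le> 6 * (n + 2)"
    "(\<Sum>z\<in>S. card (nbhd E S z)) + 2 * (\<Sum>z\<in>S. card (nbhd E T' z)) + 12 \<le> 6 * (n + 2)"
    using 1 2 cS cT T' d by (simp_all add: sum.distrib sum_distrib_left)
  \<comment> \<open>Half the sum of the two round bounds is
    \<open>a + b + c \<le> 6 * n\<close>.\<close>
  moreover have "X \<le> 6 * n + Y" if "X \<le> a + b + c + Y" "a + 2 * b + 12 \<le> 6 * (n + 2)"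
    "a + 2 * c + 12 \<le> 6 * (n + 2)" for X Y a b c :: nat
    using that by presburger
  ultimately have "d u * (n + 6) \<le> 6 * n + d u * d u" by blast
  then have "int (d u * (n + 6)) \<le> int (6 * n + d u * d u)" by (simp only: of_nat_le_iff)
  then have "0 \<le> (int (d u) - 6) * (int (d u) - int n)" by (simp add: algebra_simps)
  then show ?thesis by (auto simp: zero_le_mult_iff)
qed

text \<open>A heavy vertex misses at most two others in \<open>M\<close>, so two of them have at
  least \<open>n + 3 - 4 - 2 - 2\<close>, hence four, common neighbours in \<open>M\<close> outside
  the four. The rim around \<open>v\<close> alternates between heavy vertices and such common
  neighbours.\<close>

lemma four_heavy:
  assumes n9: "9 \<le> n" and X: "{a, b, c, e} \<subseteq> M" "distinct [a, b, c, e]"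
    and heavy: "n \<le> d a" "n \<le> d b" "n \<le> d c" "n \<le> d e"
  shows False
proof -
  let ?X = "{a, b, c, e}"
  define C where "C x y = {z \<in> M - ?X. E x z \<and> E y z}" for x y
  have miss: "card (M - {x} - nbhd E M x) \<le> 2" if "x \<in> M" "n \<le> d x" for x
  proof -
    have "nbhd E M x \<subseteq> M - {x}" using irrefl by (auto simp: nbhd_def)
    then have "card (M - {x} - nbhd E M x) = card (M - {x}) - d x"
      using finite_M by (intro card_Diff_subset) auto
    then show ?thesis using that card_M finite_M by simp
  qed
  have C4: "4 \<le> card (C x y)" if "x \<in> ?X" "y \<in> ?X" for x y
  proof -
    have xy: "x \<in> M" "y \<in> M" "n \<le> d x" "n \<le> d y" using that X heavy by auto
    have "M \<subseteq> ?X \<union> C x y \<union> (M - {x} - nbhd E M x) \<union> (M - {y} - nbhd E M y)"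
      using that by (auto simp: C_def nbhd_def)
    then have "card M \<le> card (?X \<union> C x y \<union> (M - {x} - nbhd E M x) \<union> (M - {y} - nbhd E M y))"
      using finite_M by (intro card_mono) (auto simp: C_def)
    also have "\<dots> \<le> card ?X + card (C x y) + card (M - {x} - nbhd E M x) + card (M - {y} - nbhd E M y)"
      by (rule card_Un4_le)
    also have "card ?X \<le> 4" by (simp add: card_insert_if)
    finally show ?thesis using miss[OF xy(1,3)] miss[OF xy(2,4)] card_M n9 by linarith
  qed
  obtain w x y z where "w \<in> C a b" "x \<in> C b c" "y \<in> C c e" "z \<in> C e a" "distinct [w, x, y, z]"
    by (rule distinct_representatives4[of "C a b" "C b c" "C c e" "C e a"]) (use C4 in auto)
  then show False
    using no_wheel_list[of v a w b x c y e z] X M_V v v_M vM sym by (auto simp: C_def subset_eq)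
qed

text \<open>A light vertex misses at most one vertex of \<open>B\<close>. Thus \<open>l\<close> and
  two of its light neighbours have at least \<open>n - 2 - 3\<close>, hence four, common neighbours
  in \<open>B\<close>, and a rim around \<open>l\<close> alternates between \<open>M\<close> and
  \<open>B\<close>.\<close>

lemma light_star:
  assumes n9: "9 \<le> n" and X: "{a, b, c, e} \<subseteq> M" "distinct [a, b, c, e]"
    and light: "d a \<le> 6" "d b \<le> 6" "d c \<le> 6" "d e \<le> 6"
    and l: "l \<in> M" "d l \<le> 6" "E l a" "E l b" "E l c" "E l e"
  shows False
proof -
  define C where "C x y = {z \<in> B. E l z \<and> E x z \<and> E y z}" for x y
  have miss: "card (B - nbhd E B x) \<le> 1" if "x \<in> M" "d x \<le> 6" for x
  proof -
    have "card (B - nbhd E B x) = card B - card (nbhd E B x)"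
      using finite_B by (intro card_Diff_subset) (auto simp: nbhd_subset)
    then show ?thesis using that card_nbhd_B[of x] M_V card_B by auto
  qed
  have C4: "4 \<le> card (C x y)" if "x \<in> {a, b, c, e}" "y \<in> {a, b, c, e}" for x y
  proof -
    have xy: "x \<in> M" "y \<in> M" "d x \<le> 6" "d y \<le> 6" using that X light by auto
    have "B \<subseteq> C x y \<union> (B - nbhd E B l) \<union> (B - nbhd E B x) \<union> (B - nbhd E B y)"
      by (auto simp: C_def nbhd_def)
    then have "card B \<le> card (C x y \<union> (B - nbhd E B l) \<union> (B - nbhd E B x) \<union> (B - nbhd E B y))"
      using finite_B by (intro card_mono) (auto simp: C_def)
    also have "\<dots> \<le> card (C x y) + card (B - nbhd E B l) + card (B - nbhd E B x) + card (B - nbhd E B y)"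
      by (rule card_Un4_le)
    finally show ?thesis using miss[OF xy(1,3)] miss[OF xy(2,4)] miss[OF l(1,2)] card_B n9 by linarith
  qed
  obtain w x y z where "w \<in> C a b" "x \<in> C b c" "y \<in> C c e" "z \<in> C e a" "distinct [w, x, y, z]"
    by (rule distinct_representatives4[of "C a b" "C b c" "C c e" "C e a"]) (use C4 in auto)
  then show False
    using no_wheel_list[of l a w b x c y e z] X M_V l sym irrefl by (auto simp: C_def B_def subset_eq)
qed

end

section \<open>Excluding n = 5, n = 7 and n at least 9\<close>

context dense_host
begin

text \<open>\<open>M - {u}\<close> has seven to nine vertices, so after discarding the edges inside
  \<open>T\<close> some \<open>x\<close> has degree at most three. In \<open>S\<close> this leaves
  \<open>x\<close> degree at most four in \<open>M\<close>. In \<open>T\<close> at most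
  \<open>n + 1 - d u\<close> discarded edges come back, which contradicts the hypothesis on
  \<open>d x + d u\<close>.\<close>

lemma core_case:
  assumes n7: "n \<le> 7" and u: "u \<in> M" and deg: "\<And>t. t \<in> M \<Longrightarrow> n + 5 \<le> d t + d u"
  shows False
proof -
  define S where "S = nbhd E M u"
  define T where "T = M - S - {u}"
  have uV: "u \<in> V" using u M_V by blast
  have uS: "u \<notin> S" and SM: "S \<subseteq> M" using irrefl by (auto simp: S_def nbhd_def)
  have fS: "finite S" using SM finite_M finite_subset by blast
  have fT: "finite T" using finite_M by (simp add: T_def)
  have cS: "card S = d u" by (simp add: S_def)
  have ST: "S \<union> T = M - {u}" using uS SM by (auto simp: T_def)
  have cST: "card (S \<union> T) = n + 2" using card_M u finite_M by (simp add: ST)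
  have cT: "card T = n + 2 - d u"
  proof -
    have "card (M - S) = n + 3 - d u"
      using card_Diff_subset[OF fS SM] card_M cS by simp
    then show ?thesis using u uS finite_M by (simp add: T_def)
  qed
  have h: "split_graph (cut T) S T" "\<And>xs. spath (cut T) S T xs \<Longrightarrow> length xs \<noteq> 7"
    using hub_no7[OF v uV vM[OF u], of S T] SM M_V vM
    by (auto simp: S_def T_def nbhd_def)
  interpret sg: split_graph "cut T" S T by (rule h(1))
  obtain x where x: "x \<in> S \<union> T" "card (nbhd (cut T) (S \<union> T) x) \<le> 3"
    using sg.ex_low_degree[OF h(2)] cST n5 n7 by auto
  show False
  proof (cases "x \<in> S")
    case True
    then have "x \<notin> T" by (simp add: T_def)
    then have "nbhd E M x \<subseteq> insert u (nbhd (cut T) (S \<union> T) x)"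
      unfolding ST by (auto simp: nbhd_def cut_def)
    then have "d x \<le> card (insert u (nbhd (cut T) (S \<union> T) x))"
      using fS fT by (intro card_mono) simp_all
    also have "\<dots> \<le> 4" using x(2) fS fT by (simp add: card_insert_if)
    finally show False using d_ge5[of x] True SM M_V by auto
  next
    case False
    then have xT: "x \<in> T" using x by blast
    then have "nbhd E M x \<subseteq> nbhd (cut T) (S \<union> T) x \<union> (T - {x})"
      using irrefl sym by (auto simp: nbhd_def cut_def T_def S_def)
    then have "d x \<le> card (nbhd (cut T) (S \<union> T) x \<union> (T - {x}))"
      using fS fT by (intro card_mono) simp_all
    also have "\<dots> \<le> 3 + (card T - 1)"
      using card_Un_le[of "nbhd (cut T) (S \<union> T) x" "T - {x}"] x(2) xT fT by simp
    finally have "d x + d u \<le> n + 4"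
      using cT d_le[OF u] xT fT by (cases "card T") auto
    then show False using deg[of x] xT by (simp add: T_def)
  qed
qed

text \<open>By \<open>core_case\<close> the degrees in \<open>M\<close> are at most 6 and not all
  equal to 6, so some \<open>l\<close> has degree 5 and is joined to all of \<open>B\<close>. The
  rim around \<open>l\<close> alternates between four of its neighbours in \<open>M\<close> and four
  vertices of \<open>B\<close>, among them \<open>v\<close>.\<close>

lemma n_neq_7: "n \<noteq> 7"
proof
  assume n7: "n = 7"
  have le6: "d u \<le> 6" if "u \<in> M" for u
  proof (rule ccontr)
    assume "\<not> d u \<le> 6"
    then have "n + 5 \<le> d t + d u" if "t \<in> M" for t using d_ge5[of t] that M_V n7 by fastforce
    then show False using core_case[OF _ \<open>u \<in> M\<close>] n7 by blast
  qed
  have "\<exists>l\<in>M. d l = 5"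
  proof (rule ccontr)
    assume "\<not> ?thesis"
    then have ge6: "6 \<le> d t" if "t \<in> M" for t using d_ge5[of t] that M_V by force
    obtain u where u: "u \<in> M" using card_M by fastforce
    have "n + 5 \<le> d t + d u" if "t \<in> M" for t using ge6[OF u] ge6[OF that] n7 by linarith
    then show False using core_case[OF _ u] n7 by blast
  qed
  then obtain l where l: "l \<in> M" "d l = 5" by blast
  define N where "N = nbhd E M l"
  define B' where "B' = B - {v}"
  define Q where "Q a = B' - nbhd E B a" for a
  have NM: "N \<subseteq> M" by (simp add: N_def nbhd_subset)
  have fN: "finite N" using NM finite_M finite_subset by blast
  have fB': "finite B'" and cB': "card B' = 4"
    using finite_B card_B v_B n7 by (simp_all add: B'_def)
  have "card (nbhd E B l) = card B"
    using card_nbhd_B[of l] l M_V card_B n7 card_mono[OF finite_B nbhd_subset[of E B l]] by fastforce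
  then have "nbhd E B l = B" using finite_B nbhd_subset card_subset_eq by metis
  then have lB: "E l b" if "b \<in> B" for b using that by (auto simp: nbhd_def)
  have Q1: "card (Q a) \<le> 1" if "a \<in> M" for a
  proof -
    have "card (Q a) \<le> card (B - nbhd E B a)"
      using finite_B by (intro card_mono) (auto simp: Q_def B'_def)
    also have "\<dots> = card B - card (nbhd E B a)"
      using finite_B by (intro card_Diff_subset) (auto simp: nbhd_subset)
    finally show ?thesis using that card_nbhd_B[of a] le6[of a] M_V card_B by auto
  qed
  \<comment> \<open>Each of the five neighbours of \<open>l\<close> misses at most one of four
    vertices: either one misses nothing, or two miss the same vertex.\<close>
  obtain a1 a2 where a: "a1 \<in> N" "a2 \<in> N" "a1 \<noteq> a2" "card (Q a1 \<union> Q a2) \<le> 1"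
  proof (cases "\<exists>a\<in>N. Q a = {}")
    case True
    then obtain a where a: "a \<in> N" "Q a = {}" by blast
    have "card (N - {a}) \<noteq> 0" using a fN l by (simp add: N_def)
    then obtain a' where "a' \<in> N" "a' \<noteq> a" by (metis DiffE card.empty equals0I insertI1)
    then show thesis using that[of a a'] a Q1[of a'] NM by auto
  next
    case False
    have "Q ` N \<subseteq> (\<lambda>b. {b}) ` B'"
    proof
      fix X assume "X \<in> Q ` N"
      then obtain a where a: "a \<in> N" "X = Q a" by blast
      have "finite (Q a)" using fB' by (simp add: Q_def)
      then have "card (Q a) = 1" using Q1[of a] False a NM by (metis card_0_eq le_neq_implies_less less_one subsetD)
      then obtain b where "Q a = {b}" by (auto simp: card_1_singleton_iff)
      then show "X \<in> (\<lambda>b. {b}) ` B'" using a by (auto simp: Q_def)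
    qed
    then have "card (Q ` N) \<le> card ((\<lambda>b. {b}) ` B')" using fB' by (intro card_mono) auto
    also have "\<dots> \<le> 4" using card_image_le[OF fB'] cB' by metis
    finally have "\<not> inj_on Q N" using card_image[of Q N] l by (auto simp: N_def)
    then obtain a a' where aa: "a \<in> N" "a' \<in> N" "a \<noteq> a'" "Q a = Q a'" by (auto simp: inj_on_def)
    then show thesis using that[of a a'] Q1[of a] NM by auto
  qed
  have "card (N - {a1, a2}) = 3" using a fN l by (simp add: N_def card_Diff_subset)
  then obtain a3 a4 where a34: "a3 \<in> N - {a1, a2}" "a4 \<in> N - {a1, a2}" "a3 \<noteq> a4"
    using obtain_distinct2[of "N - {a1, a2}"] by auto
  define P where "P x y = {b \<in> B'. E x b \<and> E y b}" for x y
  have P: "4 \<le> card (P x y) + card (Q x \<union> Q y)" for x y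
  proof -
    have "B' \<subseteq> P x y \<union> (Q x \<union> Q y)" by (auto simp: P_def Q_def nbhd_def B'_def)
    then have "card B' \<le> card (P x y \<union> (Q x \<union> Q y))"
      using fB' by (intro card_mono) (auto simp: P_def Q_def)
    then show ?thesis using card_Un_le[of "P x y" "Q x \<union> Q y"] cB' by linarith
  qed
  have P2: "2 \<le> card (P x y)" if "x \<in> N" "y \<in> N" for x y
    using P[of x y] card_Un_le[of "Q x" "Q y"] Q1[of x] Q1[of y] that NM by fastforce
  have P3: "3 \<le> card (P a1 a2)" using P[of a1 a2] a by linarith
  \<comment> \<open>Since \<open>v\<close> joins \<open>a3\<close> and \<open>a4\<close>, only three
    connecting vertices are chosen. The one for \<open>a1\<close> and \<open>a2\<close> comes last,
    having three candidates.\<close>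
  obtain y where y: "y \<in> P a2 a3" using P2[of a2 a3] a a34 by (metis DiffE card.empty equals0I not_numeral_le_zero)
  obtain z where z: "z \<in> P a4 a1" "z \<noteq> y"
    using P2[of a4 a1] a a34 obtain_distinct2[of "P a4 a1"] by (metis DiffE)
  have "\<not> P a1 a2 \<subseteq> {y, z}"
    using card_mono[of "{y, z}" "P a1 a2"] P3 z(2) by auto
  then obtain x where x: "x \<in> P a1 a2" "x \<noteq> y" "x \<noteq> z" by blast
  have inM: "a1 \<in> M" "a2 \<in> M" "a3 \<in> M" "a4 \<in> M" using a a34 NM by auto
  have lN: "E l a1" "E l a2" "E l a3" "E l a4" using a a34 by (auto simp: N_def nbhd_def)
  have bs: "x \<in> B" "y \<in> B" "z \<in> B" "x \<noteq> v" "y \<noteq> v" "z \<noteq> v" using x y z by (auto simp: P_def B'_def)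
  have dis: "b \<noteq> c" if "b \<in> B" "c \<in> M" for b c using that by (auto simp: B_def)
  have d9: "distinct [l, a1, x, a2, y, a3, v, a4, z]"
    using dis[OF bs(1)] dis[OF bs(2)] dis[OF bs(3)] dis[OF v_B] bs inM l(1) a(3) a34 x z lN irrefl
    by auto
  show False
    by (rule no_wheel_list[OF d9])
      (use inM M_V l v bs lB v_B lN x y z vM in \<open>auto simp: P_def B_def intro: sym\<close>)
qed

lemma n_neq_5: "n \<noteq> 5"
proof
  assume n: "n = 5"
  obtain u where u: "u \<in> M" using card_M by fastforce
  then have "n + 5 \<le> d t + d u" if "t \<in> M" for t
    using d_ge5[of t] d_ge5[of u] that M_V n by fastforce
  then show False using core_case[OF _ u] n by simp
qed

text \<open>There are at most three heavy vertices by \<open>four_heavy\<close>, and a light vertex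
  has at most three light neighbours by \<open>light_star\<close>. As degrees in \<open>M\<close>
  are at least five, every light vertex has two heavy neighbours. The rims around \<open>v\<close>
  link light paths through heavy vertices.\<close>

lemma n_less_9: "n < 9"
proof (rule ccontr)
  assume "\<not> n < 9"
  then have n9: "9 \<le> n" by simp
  define U where "U = {u \<in> M. n \<le> d u}"
  define L where "L = {l \<in> M. d l \<le> 6}"
  have UL: "U \<union> L = M" "U \<inter> L = {}"
    using degree_dichotomy n9 by (auto simp: U_def L_def)
  have UM: "U \<subseteq> M" and LM: "L \<subseteq> M" using UL by auto
  have fU: "finite U" and fL: "finite L" using finite_M finite_subset UM LM by auto
  have sum: "card U + card L = n + 3" using UL card_Un_disjoint[OF fU fL] card_M by simp
  have U3: "card U \<le> 3"
  proof (rule ccontr)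
    assume "\<not> ?thesis"
    then have "4 \<le> card U" by simp
    then obtain a b c e where "{a, b, c, e} \<subseteq> U" "distinct [a, b, c, e]"
      by (rule obtain_distinct4)
    then show False using four_heavy[OF n9, of a b c e] by (auto simp: U_def)
  qed
  have L3: "card (nbhd E L l) \<le> 3" if l: "l \<in> L" for l
  proof (rule ccontr)
    assume "\<not> ?thesis"
    then have "4 \<le> card (nbhd E L l)" by simp
    then obtain a b c e where "{a, b, c, e} \<subseteq> nbhd E L l" "distinct [a, b, c, e]"
      by (rule obtain_distinct4)
    then show False using light_star[OF n9, of a b c e l] l by (auto simp: L_def nbhd_def)
  qed
  have ULd: "5 \<le> card (nbhd E U l) + card (nbhd E L l)" if "l \<in> L" for l
  proof -
    have "nbhd E M l = nbhd E U l \<union> nbhd E L l" using UL by (auto simp: nbhd_def)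
    then have "d l \<le> card (nbhd E U l) + card (nbhd E L l)" by (simp add: card_Un_le)
    then show ?thesis using d_ge5[of l] that LM M_V by force
  qed
  have U2: "2 \<le> card (nbhd E U l)" if "l \<in> L" for l
    using L3[OF that] ULd[OF that] by linarith
  have Ule: "card (nbhd E U l) \<le> card U" for l
    using fU by (intro card_mono nbhd_subset)
  have L9: "9 \<le> card L" using sum U3 n9 by linarith
  then obtain l0 where "l0 \<in> L" by (metis card.empty equals0I not_numeral_le_zero)
  then consider "card U = 2" | "card U = 3" using U2[of l0] Ule[of l0] U3 by linarith
  then show False
  proof cases
    case 1
    then obtain u w where uw: "U = {u, w}" "u \<noteq> w" by (auto simp: card_2_iff)
    have all: "E l u" "E l w" if "l \<in> L" for l
    proof -
      have "nbhd E U l = U"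
        using U2[OF that] Ule[of l] 1 fU nbhd_subset card_subset_eq by (metis le_antisym)
      then show "E l u" "E l w" using uw by (auto simp: nbhd_def)
    qed
    have deg3: "card (nbhd E L l) = 3" if "l \<in> L" for l
      using ULd[OF that] L3[OF that] Ule[of l] 1 by linarith
    obtain x where x: "x \<in> L" using \<open>l0 \<in> L\<close> by blast
    obtain y z where yz: "y \<in> nbhd E L x" "z \<in> nbhd E L x" "y \<noteq> z"
      using obtain_distinct2[of "nbhd E L x"] deg3[OF x] by auto
    have yzL: "y \<in> L" "z \<in> L" "E x y" "E x z" "y \<noteq> x" "z \<noteq> x"
      using yz irrefl by (auto simp: nbhd_def)
    define L' where "L' = L - {x, y, z}"
    have fL': "finite L'" using fL by (simp add: L'_def)
    have "card L' = card L - 3"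
      using x yzL yz(3) fL by (simp add: L'_def card_Diff_subset)
    then have cL': "7 \<le> card L'" using sum 1 n9 by linarith
    \<comment> \<open>Otherwise at least seven vertices each send two edges to \<open>x\<close>,
      \<open>y\<close>, \<open>z\<close>, which together have only nine light neighbours counted
      with multiplicity.\<close>
    have "\<exists>p\<in>L'. 2 \<le> card (nbhd E L' p)"
    proof (rule ccontr)
      assume no: "\<not> ?thesis"
      have "2 \<le> card (nbhd E {x, y, z} p)" if p: "p \<in> L'" for p
      proof -
        have "nbhd E L p = nbhd E L' p \<union> nbhd E {x, y, z} p"
          using x yzL by (auto simp: nbhd_def L'_def)
        then have "3 \<le> card (nbhd E L' p) + card (nbhd E {x, y, z} p)"
          using deg3[of p] p card_Un_le by (metis L'_def DiffE)
        then show ?thesis using no p by force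
      qed
      then have "card L' * 2 \<le> (\<Sum>p\<in>L'. card (nbhd E {x, y, z} p))"
        using sum_bounded_below[of L' "2 :: nat"] by simp
      also have "\<dots> = (\<Sum>p\<in>L'. \<Sum>q\<in>{x, y, z}. if E p q then 1 else 0)"
        by (simp add: nbhd_def sum.If_cases Int_def del: sum.insert)
      also have "\<dots> = (\<Sum>q\<in>{x, y, z}. \<Sum>p\<in>L'. if E p q then 1 else 0)" by (rule sum.swap)
      also have "\<dots> = (\<Sum>q\<in>{x, y, z}. card {p \<in> L'. E p q})"
        using fL' by (simp add: sum.If_cases Int_def del: sum.insert)
      also have "\<dots> \<le> (\<Sum>q\<in>{x, y, z}. 3)"
      proof (rule sum_mono)
        fix q assume q: "q \<in> {x, y, z}"
        have "{p \<in> L'. E p q} \<subseteq> nbhd E L q" by (auto simp: nbhd_def L'_def intro: sym)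
        then have "card {p \<in> L'. E p q} \<le> card (nbhd E L q)" using fL by (intro card_mono) auto
        then show "card {p \<in> L'. E p q} \<le> 3" using deg3[of q] q x yzL by auto
      qed
      also have "\<dots> \<le> 9" by (simp add: card_insert_if)
      finally show False using cL' by linarith
    qed
    then obtain p where p: "p \<in> L'" "2 \<le> card (nbhd E L' p)" by blast
    obtain q r where qr: "q \<in> nbhd E L' p" "r \<in> nbhd E L' p" "q \<noteq> r"
      using obtain_distinct2[OF p(2)] by blast
    have pqr: "q \<in> L'" "r \<in> L'" "E p q" "E p r" "q \<noteq> p" "r \<noteq> p"
      using qr irrefl by (auto simp: nbhd_def)
    \<comment> \<open>The light paths \<open>y x z\<close> and \<open>q p r\<close> are linked by
      \<open>u\<close> and \<open>w\<close>, which are joined to every light vertex.\<close>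
    have inM: "{u, y, x, z, w, q, p, r} \<subseteq> M"
      using uw UM LM x yzL p pqr by (auto simp: L'_def)
    have inL: "{y, z, q, r} \<subseteq> L" using yzL pqr by (auto simp: L'_def)
    have "u \<notin> L" "w \<notin> L" using uw UL by auto
    then have d9: "distinct [v, u, y, x, z, w, q, p, r]"
      using v_M inM uw(2) x yzL yz(3) p pqr qr(3) by (auto simp: L'_def)
    show False
      by (rule no_wheel_list[OF d9])
        (use inM inL M_V v vM all yzL pqr in \<open>auto intro: sym\<close>)
  next
    case 2
    have miss1: "E l s \<or> E l t" if "l \<in> L" "s \<in> U" "t \<in> U" "s \<noteq> t" for l s t
    proof (rule ccontr)
      assume "\<not> ?thesis"
      then have "nbhd E U l \<subseteq> U - {s, t}" by (auto simp: nbhd_def)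
      then have "card (nbhd E U l) \<le> card (U - {s, t})" using fU by (intro card_mono) auto
      also have "\<dots> = 1" using that 2 fU by (simp add: card_Diff_subset)
      finally show False using U2[OF that(1)] by simp
    qed
    have few: "card {l \<in> L. \<not> E l s} \<le> 2" if "s \<in> U" for s
    proof -
      have sM: "s \<in> M" "n \<le> d s" "s \<notin> L" using that UL by (auto simp: U_def)
      have "{l \<in> L. \<not> E l s} \<subseteq> M - {s} - nbhd E M s"
        using LM sM sym by (auto simp: nbhd_def)
      then have "card {l \<in> L. \<not> E l s} \<le> card (M - {s} - nbhd E M s)"
        using finite_M by (intro card_mono) auto
      also have "\<dots> = card (M - {s}) - d s"
        using finite_M irrefl by (intro card_Diff_subset) (auto simp: nbhd_def)
      finally show ?thesis using sM card_M finite_M by simp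
    qed
    have Ldeg: "2 \<le> card (nbhd E L l)" if "l \<in> L" for l
      using ULd[OF that] Ule[of l] 2 by linarith
    obtain u1 u2 u3 where u: "U = {u1, u2, u3}" "distinct [u1, u2, u3]"
      using 2 by (auto simp: card_3_iff)
    \<comment> \<open>Three heavy vertices miss at most two light ones each, and there are at least
      nine light vertices.\<close>
    have "\<not> L \<subseteq> {l \<in> L. \<not> E l u1} \<union> {l \<in> L. \<not> E l u2} \<union> {l \<in> L. \<not> E l u3} \<union> {}"
      (is "\<not> L \<subseteq> ?R")
    proof
      assume "L \<subseteq> ?R"
      then have "card L \<le> card ?R" using fL by (intro card_mono) auto
      then show False
        using card_Un4_le[of "{l \<in> L. \<not> E l u1}" "{l \<in> L. \<not> E l u2}" "{l \<in> L. \<not> E l u3}" "{}"]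
          few[of u1] few[of u2] few[of u3] u(1) L9 by simp
    qed
    then obtain x where x: "x \<in> L" "\<And>s. s \<in> U \<Longrightarrow> E x s" using u(1) by auto
    obtain y where y: "y \<in> L" "E x y" "y \<noteq> x"
      using obtain_distinct2[OF Ldeg[OF x(1)]] irrefl by (auto simp: nbhd_def)
    \<comment> \<open>A light edge disjoint from \<open>x y\<close>. Without one, every further
      light vertex would need \<open>x\<close> as a neighbour, which is too many for
      \<open>x\<close>.\<close>
    have "\<exists>p\<in>L - {x, y}. \<exists>q\<in>L - {x, y}. E p q"
    proof (rule ccontr)
      assume no: "\<not> ?thesis"
      have "E x p" if p: "p \<in> L - {x, y}" for p
      proof (rule ccontr)
        assume "\<not> E x p"
        then have "nbhd E L p \<subseteq> {y}" using no p sym by (auto simp: nbhd_def)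
        then have "card (nbhd E L p) \<le> card {y}" by (intro card_mono) auto
        then show False using Ldeg[of p] p by simp
      qed
      then have "L - {x, y} \<subseteq> nbhd E L x" by (auto simp: nbhd_def)
      then have "card (L - {x, y}) \<le> card (nbhd E L x)" using fL by (intro card_mono) auto
      then show False using L3[OF x(1)] L9 x y fL by (simp add: card_Diff_subset)
    qed
    then obtain p q where pq: "p \<in> L" "q \<in> L" "p \<notin> {x, y}" "q \<notin> {x, y}" "E p q" by auto
    have pq': "p \<noteq> q" using pq irrefl by auto
    \<comment> \<open>The heavy \<open>a\<close>, \<open>b\<close>, \<open>c\<close> separate the
      vertex \<open>z\<close>, the edge \<open>p q\<close> and the edge \<open>x y\<close> on the
      rim. Because \<open>x\<close> sees all heavy vertices, it suffices that \<open>y\<close> sees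
      one of \<open>a\<close> and \<open>c\<close>; the edges \<open>p q\<close> and
      \<open>x y\<close> may each be traversed either way.\<close>
    have finish: False
      if U: "U = {a, b, c}" "distinct [a, b, c]" and z: "z \<in> L - {x, y, p, q}" "E z a" "E z b"
        and f: "E p b \<and> E q c \<or> E q b \<and> E p c" for a b c z
    proof -
      have inM: "{a, b, c, x, y, z, p, q} \<subseteq> M" using U UM LM x y z pq by auto
      have "a \<notin> L" "b \<notin> L" "c \<notin> L" using U UL by auto
      then have ds: "distinct [v, a, z, b, p, q, c, x, y]"
        using v_M inM U(2) x y z pq pq' by auto
      then have "distinct [v, a, z, b, p, q, c, y, x]" "distinct [v, a, z, b, q, p, c, x, y]"
        "distinct [v, a, z, b, q, p, c, y, x]" by auto
      note rim = no_wheel_list[OF ds] no_wheel_list[OF this(1)] no_wheel_list[OF this(2)]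
        no_wheel_list[OF this(3)]
      have hub: "E v a" "E v b" "E v c" "E v x" "E v y" "E v z" "E v p" "E v q"
        using inM vM by auto
      have s: "E x a" "E x c" "E a x" "E c x" "E a z" "E y x" "E q p" "E x y" "E p q"
        using x(2) U y pq z sym by auto
      have V: "{v, a, z, b, p, q, c, x, y} \<subseteq> V" using inM M_V v by auto
      have "E y a \<or> E y c" using miss1[OF y(1)] U by auto
      then show False
      proof
        assume "E y a"
        then show False
          using f rim(1) rim(3) hub s V z sym[of p] sym[of q] by auto
      next
        assume "E y c"
        then have "E c y" by (rule sym)
        then show False
          using f rim(2) rim(4) hub s V z sym[of p] sym[of q] by auto
      qed
    qed
    have big: "5 \<le> card (L - {x, y, p, q})"
    proof -
      have "card {x, y, p, q} \<le> 4" using card_length[of "[x, y, p, q]"] by simp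
      then show ?thesis using diff_card_le_card_Diff[of "{x, y, p, q}" L] L9 by simp
    qed
    show False
    \<comment> \<open>A heavy vertex seen by neither \<open>p\<close> nor \<open>q\<close> must take
      the position \<open>a\<close>, the only one not next to the edge \<open>p q\<close>.\<close>
    proof (cases "\<exists>k\<in>U. \<not> E p k \<and> \<not> E q k")
      case True
      then obtain k where k: "k \<in> U" "\<not> E p k" "\<not> E q k" by blast
      obtain i j where ij: "U = {k, i, j}" "distinct [k, i, j]"
        using k(1) u by auto
      have "\<not> L - {x, y, p, q} \<subseteq> {l \<in> L. \<not> E l k}"
        using card_mono[of "{l \<in> L. \<not> E l k}" "L - {x, y, p, q}"] few[OF k(1)] big fL by auto
      then obtain z where z: "z \<in> L - {x, y, p, q}" "E z k" by auto
      have pqij: "E p i" "E p j" "E q i" "E q j"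
        using miss1[of p k i] miss1[of p k j] miss1[of q k i] miss1[of q k j] pq k ij by auto
      have "E z i \<or> E z j" using miss1[of z i j] z ij by auto
      then show False
        using finish[of k i j z] finish[of k j i z] ij z pqij by auto
    next
      case False
      have "L - {x, y, p, q} \<noteq> {}" using big by (metis card.empty not_numeral_le_zero)
      then obtain z where z: "z \<in> L - {x, y, p, q}" by blast
      obtain a b c where abc: "U = {a, b, c}" "distinct [a, b, c]" "E z a" "E z b"
      proof -
        have "E z u1 \<and> E z u2 \<or> E z u2 \<and> E z u3 \<or> E z u3 \<and> E z u1"
          using miss1[of z u1 u2] miss1[of z u2 u3] miss1[of z u3 u1] z u by auto
        then show thesis
          using that[of u1 u2 u3] that[of u2 u3 u1] that[of u3 u1 u2] u by auto
      qed
      have "E p b \<and> E q c \<or> E q b \<and> E p c"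
        using False miss1[of p b c] miss1[of q b c] pq abc by auto
      then show False using finish[OF abc(1,2) z abc(3,4)] by blast
    qed
  qed
qed

end

lemma obtain_subset_containing:
  assumes "l \<in> A" "1 \<le> k" "k \<le> card A"
  obtains X where "X \<subseteq> A" "card X = k" "l \<in> X"
proof -
  have fA: "finite A" using assms card.infinite by fastforce
  have "k - 1 \<le> card (A - {l})" using assms fA by simp
  then obtain Y where Y: "Y \<subseteq> A - {l}" "card Y = k - 1" by (meson obtain_subset_with_card_n)
  have "finite Y" using Y fA finite_subset by blast
  then have "card (insert l Y) = k" using Y assms(2) by (auto simp: card_insert_if)
  then show thesis using that[of "insert l Y"] Y assms by auto
qed

section \<open>The upper bound\<close>

text \<open>An embedding of \<open>S\<^sub>n(1,1)\<close>: centre \<open>c\<close>, its neighbours \<open>X\<close>, and a pendant vertex \<open>w\<close> at \<open>l\<close>.\<close>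

definition star11 :: "('a \<Rightarrow> 'a \<Rightarrow> bool) \<Rightarrow> 'a set \<Rightarrow> nat \<Rightarrow> bool" where
  "star11 F V n \<longleftrightarrow> (\<exists>c l w X. c \<in> V \<and> w \<in> V \<and> X \<subseteq> V \<and> card X = n - 2 \<and> l \<in> X \<and> c \<notin> X \<and> w \<notin> X \<and>
     w \<noteq> c \<and> (\<forall>x\<in>X. F c x) \<and> F l w)"

text \<open>The cases are a vertex with at least \<open>n - 1\<close> non-neighbours in
  \<open>E\<close>, a maximum of exactly \<open>n - 2\<close>, and a smaller maximum. In the last
  case all degrees in \<open>E\<close> are at least \<open>n + 3\<close> and
  \<open>dense_host\<close> applies.\<close>

theorem wheel8_or_star11:
  fixes E F :: "'a \<Rightarrow> 'a \<Rightarrow> bool"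
  assumes fin: "finite V" and card_V: "card V = 2 * n + 1" and n: "odd n" "5 \<le> n"
    and sym: "\<And>x y. E x y \<Longrightarrow> E y x" and irrefl: "\<And>x. \<not> E x x"
    and F: "\<And>x y. x \<in> V \<Longrightarrow> y \<in> V \<Longrightarrow> x \<noteq> y \<Longrightarrow> \<not> E x y \<Longrightarrow> F x y"
  shows "wheel8 E V \<or> star11 F V n"
proof (rule ccontr)
  assume neither: "\<not> ?thesis"
  interpret host E V
    using fin sym irrefl neither by unfold_locales auto
  have no_star: False
    if "c \<in> V" "w \<in> V" "X \<subseteq> V" "card X = n - 2" "l \<in> X" "c \<notin> X" "w \<notin> X" "w \<noteq> c"
      "\<And>x. x \<in> X \<Longrightarrow> \<not> E c x" "\<not> E l w" for c l w X
  proof -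
    have "\<forall>x\<in>X. F c x" using that F by (metis subsetD)
    moreover have "F l w" using that F by (metis subsetD)
    ultimately have "star11 F V n"
      unfolding star11_def using that(1-8) by blast
    then show False using neither by blast
  qed
  define N where "N x = V - {x} - nbhd E V x" for x
  have NV: "N x \<subseteq> V" for x by (auto simp: N_def)
  have fN: "finite (N x)" for x using fin by (simp add: N_def)
  have N_iff: "y \<in> N x \<longleftrightarrow> y \<in> V \<and> y \<noteq> x \<and> \<not> E x y" for x y by (auto simp: N_def nbhd_def)
  have N_sym: "x \<in> N y" if "y \<in> N x" "x \<in> V" for x y using that sym by (auto simp: N_iff)
  have cN: "card (N x) + card (nbhd E V x) = 2 * n" if "x \<in> V" for x
  proof -
    have "nbhd E V x \<subseteq> V - {x}" using irrefl by (auto simp: nbhd_def)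
    then show ?thesis
      using fin that card_V card_mono[of "V - {x}" "nbhd E V x"]
      by (simp add: N_def card_Diff_subset)
  qed
  \<comment> \<open>A second non-neighbour \<open>w\<close> of \<open>l\<close> would be a pendant
    vertex: there is one non-neighbour of \<open>c\<close> to spare, so \<open>n - 2\<close> of them
    including \<open>l\<close> can be chosen without \<open>w\<close>.\<close>
  have big: "N l = {c}" if c: "c \<in> V" "n - 1 \<le> card (N c)" "l \<in> N c" for c l
  proof (rule ccontr)
    assume "N l \<noteq> {c}"
    moreover have "c \<in> N l" using c N_sym by blast
    ultimately obtain w where w: "w \<in> N l" "w \<noteq> c" by blast
    have "l \<noteq> w" using w by (auto simp: N_iff)
    then have "l \<in> N c - {w}" using c by simp
    moreover have "n - 2 \<le> card (N c - {w})"
      using c(2) diff_card_le_card_Diff[of "{w}" "N c"] by simp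
    moreover have "1 \<le> n - 2" using n by simp
    ultimately obtain X where X: "X \<subseteq> N c - {w}" "card X = n - 2" "l \<in> X"
      using obtain_subset_containing[of l "N c - {w}" "n - 2"] by blast
    show False
      by (rule no_star[of c w X l]) (use c w X N_iff in auto)
  qed
  show False
  proof (cases "\<exists>c\<in>V. n - 1 \<le> card (N c)")
    case True
    then obtain c where c: "c \<in> V" "n - 1 \<le> card (N c)" by blast
    define L where "L = N c"
    have L: "L \<subseteq> V" "c \<notin> L" "finite L" using fN NV by (auto simp: L_def N_iff)
    have adj: "E l y" if "l \<in> L" "y \<in> V" "y \<noteq> l" "y \<noteq> c" for l y
      using big[OF c, of l] that by (auto simp: L_def N_iff set_eq_iff)
    have L4: "4 \<le> card L" using c n by (simp add: L_def)
    show False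
    proof (cases "5 \<le> card L")
      case True
      obtain l where l: "l \<in> L" using L4 by fastforce
      have "4 \<le> card (L - {l})" using True l L by simp
      then obtain x1 x2 x3 x4 where x: "{x1, x2, x3, x4} \<subseteq> L - {l}" "distinct [x1, x2, x3, x4]"
        by (rule obtain_distinct4)
      have "card (V - {c, l, x1, x2, x3, x4}) = card V - card {c, l, x1, x2, x3, x4}"
        using c l x L by (intro card_Diff_subset) auto
      moreover have "card {c, l, x1, x2, x3, x4} \<le> 6" by (simp add: card_insert_if)
      ultimately have "4 \<le> card (V - {c, l, x1, x2, x3, x4})" using card_V n by linarith
      then obtain y1 y2 y3 y4 where y: "{y1, y2, y3, y4} \<subseteq> V - {c, l, x1, x2, x3, x4}"
          "distinct [y1, y2, y3, y4]"
        by (rule obtain_distinct4)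
      have "E s t" if "s \<in> {l, x1, x2, x3, x4}" "t \<in> {x1, x2, x3, x4, y1, y2, y3, y4}" "s \<noteq> t" for s t
        using that l x y L by (intro adj) auto
      then show False
        using no_wheel_list[of l x1 y1 x2 y2 x3 y3 x4 y4] l x y L
        by (auto intro: sym)
    next
      case False
      then have k4: "card L = 4" and n5: "n = 5" using L4 c n by (auto simp: L_def)
      define R where "R = V - insert c L"
      have "card (insert c L) = 5" using L k4 by simp
      then have cR: "card R = 6"
        using card_Diff_subset[of "insert c L" V] L c card_V n5 by (simp add: R_def)
      have fR: "finite R" using fin by (simp add: R_def)
      \<comment> \<open>Besides the hub only three vertices of \<open>L\<close> remain for the rim,
        so it needs a path \<open>s r t\<close> inside \<open>R\<close>. At most three
        non-neighbours leave \<open>r\<close> two neighbours in \<open>R\<close>.\<close>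
      obtain r where r: "r \<in> R" "card (N r) \<le> 3"
      proof -
        obtain r0 where r0: "r0 \<in> R" using cR by fastforce
        show thesis
        proof (cases "card (N r0) \<le> 3")
          case True then show thesis using that r0 by blast
        next
          case False
          then obtain r where r: "r \<in> N r0" by fastforce
          have r0V: "r0 \<in> V" "r0 \<notin> L" "r0 \<noteq> c" using r0 by (auto simp: R_def)
          have Nr: "N r = {r0}" using big[of r0 r] r False r0V n5 by auto
          have "r \<noteq> c" using r r0V N_sym by (auto simp: L_def)
          moreover have "r \<notin> L" using big[OF c, of r] Nr r0V by (auto simp: L_def)
          ultimately have "r \<in> R" using r NV by (auto simp: R_def)
          then show thesis using that[of r] Nr by simp
        qed
      qed
      have "R - {r} \<subseteq> nbhd E R r \<union> N r" by (auto simp: nbhd_def N_iff R_def)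
      then have "card (R - {r}) \<le> card (nbhd E R r \<union> N r)"
        using fR fN by (intro card_mono) auto
      then have "2 \<le> card (nbhd E R r)"
        using card_Un_le[of "nbhd E R r" "N r"] r cR fR by simp
      then obtain s t where st: "s \<in> nbhd E R r" "t \<in> nbhd E R r" "s \<noteq> t"
        by (rule obtain_distinct2)
      have st': "s \<in> R" "t \<in> R" "E r s" "E r t" "s \<noteq> r" "t \<noteq> r"
        using st irrefl by (auto simp: nbhd_def)
      have "2 \<le> card (R - {r, s, t})"
        using r st(3) st' cR fR by (simp add: card_Diff_subset)
      then obtain p q where pq: "p \<in> R - {r, s, t}" "q \<in> R - {r, s, t}" "p \<noteq> q"
        by (rule obtain_distinct2)
      obtain l x y z where lx: "{l, x, y, z} \<subseteq> L" "distinct [l, x, y, z]"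
        using L4 by (rule obtain_distinct4)
      have "E a b" if "a \<in> {l, x, y, z}" "b \<in> {x, y, z, r, s, t, p, q}" "a \<noteq> b" for a b
        using that lx L r st' pq by (intro adj) (auto simp: R_def)
      then show False
        using no_wheel_list[of l x s r t y p z q] lx r st' st(3) pq L
        by (auto intro: sym simp: R_def)
    qed
  next
    case False
    then have small: "card (N x) \<le> n - 2" if "x \<in> V" for x using that n by force
    show False
    proof (cases "\<exists>c\<in>V. card (N c) = n - 2")
      case True
      then obtain c where c: "c \<in> V" "card (N c) = n - 2" by blast
      define C where "C = insert c (N c)"
      define R where "R = V - C"
      have C: "C \<subseteq> V" "finite C" using c fN NV by (auto simp: C_def)
      have cC: "card C = n - 1" using c fN n by (simp add: C_def N_iff)
      have cR: "card R = n + 2" using card_Diff_subset[OF C(2,1)] cC card_V n by (simp add: R_def)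
      have fR: "finite R" using fin by (simp add: R_def)
      \<comment> \<open>For \<open>x\<close> in \<open>N c\<close>, a missing edge to
        \<open>r\<close> would make \<open>r\<close> the pendant vertex of a star with centre
        \<open>c\<close> and neighbours \<open>N c\<close>.\<close>
      have adj: "E x r" if "x \<in> C" "r \<in> R" for x r
      proof (rule ccontr)
        assume no: "\<not> E x r"
        have "x \<noteq> c" using no that by (auto simp: R_def C_def N_iff)
        then have "x \<in> N c" using that by (simp add: C_def)
        then show False
          using no_star[of c r "N c" x] no that c NV by (auto simp: R_def C_def N_iff)
      qed
      have le3: "card (nbhd E R r) \<le> 3" if r: "r \<in> R" for r
      proof (rule ccontr)
        assume "\<not> ?thesis"
        then have "4 \<le> card (nbhd E R r)" by simp
        then obtain y1 y2 y3 y4 where y: "{y1, y2, y3, y4} \<subseteq> nbhd E R r" "distinct [y1, y2, y3, y4]"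
          by (rule obtain_distinct4)
        have "4 \<le> card C" using cC n by simp
        then obtain x1 x2 x3 x4 where x: "{x1, x2, x3, x4} \<subseteq> C" "distinct [x1, x2, x3, x4]"
          by (rule obtain_distinct4)
        have y': "{y1, y2, y3, y4} \<subseteq> R" "E r y1" "E r y2" "E r y3" "E r y4"
          using y by (auto simp: nbhd_def)
        have CR: "C \<inter> R = {}" by (auto simp: R_def)
        have "E s t" "E t s" if "s \<in> {x1, x2, x3, x4}" "t \<in> {r, y1, y2, y3, y4}" for s t
          using that x y' r adj[of s t] sym by auto
        then have "E r x1" "E r x2" "E r x3" "E r x4" "E x1 y1" "E y1 x2" "E x2 y2" "E y2 x3"
          "E x3 y3" "E y3 x4" "E x4 y4" "E y4 x1"
          by simp_all
        moreover have "distinct [r, x1, y1, x2, y2, x3, y3, x4, y4]"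
          using x y(2) y' CR r irrefl by auto
        moreover have "R \<subseteq> V" by (auto simp: R_def)
        then have "{r, x1, y1, x2, y2, x3, y3, x4, y4} \<subseteq> V" using y'(1) x(1) r C(1) by blast
        ultimately show False
          using no_wheel_list[of r x1 y1 x2 y2 x3 y3 x4 y4] y'(2-5) by simp
      qed
      \<comment> \<open>The non-neighbours of \<open>r\<close> all lie in \<open>R\<close>, and at
        most \<open>n - 2\<close> of the \<open>n + 1\<close> other vertices there are such.\<close>
      have eq3: "card (nbhd E R r) = 3" if r: "r \<in> R" for r
      proof -
        have "N r = R - {r} - nbhd E R r"
          using adj[OF _ r] sym by (auto simp: N_iff nbhd_def R_def)
        moreover have "nbhd E R r \<subseteq> R - {r}" using irrefl by (auto simp: nbhd_def)
        ultimately have "card (N r) = n + 1 - card (nbhd E R r)"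
          using fR r cR by (simp add: card_Diff_subset)
        then show ?thesis using small[of r] le3[OF r] r n by (auto simp: R_def)
      qed
      have "degsum E R = 3 * (n + 2)" using eq3 cR by (simp add: degsum_def)
      then show False using even_degsum[of E R] sym irrefl fR n by auto
    next
      case False
      have "V \<noteq> {}" using card_V by auto
      then obtain v where v: "v \<in> V" by blast
      have deg: "n + 3 \<le> card (nbhd E V x)" if "x \<in> V" for x
        using small[OF that] False that cN[OF that] n by force
      obtain M where M: "M \<subseteq> nbhd E V v" "card M = n + 3"
        using deg[OF v] by (meson obtain_subset_with_card_n)
      interpret dense_host E V n v M
        using n card_V deg v M by unfold_locales auto
      have "n \<noteq> 6" "n \<noteq> 8" using n by auto
      then show False using n_neq_5 n_neq_7 n_less_9 n by linarith
    qed
  qed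
qed

section \<open>The lower bound\<close>

text \<open>The index of the component of \<open>i\<close>. For odd \<open>n\<close>,
  \<open>n + 1\<close> is 0 or 2 modulo 4. In the second case the first six vertices form one block
  and the shift by 2 aligns the blocks of four that start at 6; the index 1 does not occur.\<close>

definition block :: "nat \<Rightarrow> nat \<Rightarrow> nat" where
  "block n i = (if 4 dvd n + 1 then i div 4 else if i < 6 then 0 else (i + 2) div 4)"

text \<open>
  A cubic graph on \<open>{..n}\<close>, \<open>n\<close> odd, whose components are copies of \<open>K\<^sub>4\<close> and at most one
  \<open>K\<^bsub>3,3\<^esub>\<close>: it has no cycle of length 8.
\<close>

definition cubic :: "nat \<Rightarrow> nat \<Rightarrow> nat \<Rightarrow> bool" where
  "cubic n i j \<longleftrightarrow> i \<noteq> j \<and> block n i = block n j \<and> (4 dvd n + 1 \<or> 6 \<le> i \<or> odd (i + j))"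

lemma card_block_le: "card {j. j \<le> n \<and> block n j = b} \<le> 6"
proof -
  have "\<exists>X. {j. j \<le> n \<and> block n j = b} \<subseteq> X \<and> finite X \<and> card X \<le> 6"
  proof (cases "4 dvd n + 1")
    case True
    then have "{j. j \<le> n \<and> block n j = b} \<subseteq> {4 * b..<4 * b + 4}"
      by (auto simp: block_def)
    then show ?thesis by (intro exI[of _ "{4 * b..<4 * b + 4}"]) auto
  next
    case False
    show ?thesis
    proof (cases "b = 0")
      case True
      have "{j. j \<le> n \<and> block n j = b} \<subseteq> {..<6}"
        using True False by (auto simp: block_def split: if_splits)
      then show ?thesis by (intro exI[of _ "{..<6}"]) auto
    next
      case b: False
      have "{j. j \<le> n \<and> block n j = b} \<subseteq> {4 * b - 2..<4 * b + 2}"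
        using b False by (auto simp: block_def split: if_splits)
      then show ?thesis by (intro exI[of _ "{4 * b - 2..<4 * b + 2}"]) auto
    qed
  qed
  then show ?thesis by (meson card_mono order_trans)
qed

lemma div4_eq_iff: "(j::nat) div 4 = m \<longleftrightarrow> 4 * m \<le> j \<and> j < 4 * m + 4"
  by auto

lemma card_cubic:
  assumes "odd n" "5 \<le> n" "i \<le> n"
  shows "card {j. j \<le> n \<and> cubic n i j} = 3"
proof (cases "4 dvd n + 1")
  case True
  define m where "m = i div 4"
  obtain k where k: "n + 1 = 4 * k" using True by (rule dvdE)
  have m: "4 * m \<le> i" "i < 4 * m + 4" using div4_eq_iff[of i m] by (simp_all add: m_def)
  have "4 * m < 4 * k" using m(1) k assms(3) by linarith
  then have "4 * m + 4 \<le> n + 1" using k by simp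
  then have "{j. j \<le> n \<and> cubic n i j} = {4 * m..<4 * m + 4} - {i}"
    using True by (auto simp: cubic_def block_def div4_eq_iff m_def[symmetric])
  moreover have "i \<in> {4 * m..<4 * m + 4}" using m by simp
  ultimately show ?thesis by simp
next
  case False
  show ?thesis
  proof (cases "i < 6")
    case True
    have "{j. j \<le> n \<and> cubic n i j} = {j. j < 6 \<and> odd (i + j)}"
      using True False assms by (auto simp: cubic_def block_def split: if_splits)
    also have "\<dots> = {j \<in> {0, 1, 2, 3, 4, 5}. odd (i + j)}"
      by (auto simp: numeral_eq_Suc less_Suc_eq)
    also have "\<dots> = (if even i then {1, 3, 5} else {0, 2, 4})" by auto
    finally show ?thesis by simp
  next
    case i6: False
    define m where "m = (i + 2) div 4"
    have m: "4 * m \<le> i + 2" "i + 2 < 4 * m + 4" using div4_eq_iff[of "i + 2" m] by (simp_all add: m_def)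
    then have "2 \<le> m" using i6 by linarith
    \<comment> \<open>\<open>b\<close> is the first vertex of the block containing
      \<open>i\<close>.\<close>
    then obtain b where b: "4 * m = b + 2" "6 \<le> b" using that[of "4 * m - 2"] by linarith
    \<comment> \<open>The last block is complete, since here \<open>n = 4 * k + 1\<close>.\<close>
    have "b + 3 \<le> n"
    proof -
      obtain a where a: "n = 2 * a + 1" using assms(1) by (rule oddE)
      have "even a"
      proof (rule ccontr)
        assume "odd a"
        then obtain c where "a = 2 * c + 1" by (rule oddE)
        then have "n + 1 = 4 * (c + 1)" using a by simp
        then show False using False dvd_triv_left by metis
      qed
      then obtain k where k: "a = 2 * k" by (rule evenE)
      have "m \<le> k" using m(1) assms(3) a k by linarith
      then show ?thesis using a k b by linarith
    qed
    have "block n i = m" using False i6 by (simp only: block_def m_def if_False)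
    have block: "block n i = block n j \<longleftrightarrow> b \<le> j \<and> j < b + 4" for j
    proof (cases "j < 6")
      case True
      then have "block n j = 0" using False by (simp only: block_def if_False if_True)
      then show ?thesis using \<open>block n i = m\<close> \<open>2 \<le> m\<close> True b(2) by linarith
    next
      case j6: False
      then have "block n j = (j + 2) div 4" using False by (simp only: block_def if_False)
      moreover have "(j + 2) div 4 = m \<longleftrightarrow> b \<le> j \<and> j < b + 4"
        by (simp only: div4_eq_iff b(1)) linarith
      ultimately show ?thesis using \<open>block n i = m\<close> by metis
    qed
    have "6 \<le> i" using i6 by simp
    then have "j \<le> n \<and> cubic n i j \<longleftrightarrow> j \<in> {b..<b + 4} - {i}" for j
      unfolding cubic_def block[of j] using \<open>b + 3 \<le> n\<close> by auto
    then have "{j. j \<le> n \<and> cubic n i j} = {b..<b + 4} - {i}" by blast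
    moreover have "i \<in> {b..<b + 4}" using m b by simp
    ultimately show ?thesis by simp
  qed
qed

lemma cubic_sym: "cubic n i j \<Longrightarrow> cubic n j i"
  by (auto simp: cubic_def block_def split: if_splits)

text \<open>\<open>K\<^bsub>n-1\<^esub>\<close> on \<open>{n<..<2n}\<close>, disjoint from the complement of the cubic graph on \<open>{..n}\<close>.\<close>

definition extremal :: "nat \<Rightarrow> nat \<Rightarrow> nat \<Rightarrow> bool" where
  "extremal n i j \<longleftrightarrow> i \<noteq> j \<and> (n < i \<and> n < j \<or> i \<le> n \<and> j \<le> n \<and> \<not> cubic n i j)"

text \<open>A centre in the clique would force all \<open>n\<close> vertices into a component of
  order \<open>n - 1\<close>. A centre in the other part has degree \<open>n - 3\<close>, one too
  few.\<close>

lemma extremal_no_star11: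
  assumes n: "odd n" "5 \<le> n"
  shows "\<not> star11 (extremal n) {..<2 * n} n"
proof
  assume "star11 (extremal n) {..<2 * n} n"
  then obtain c l w X where *: "c < 2 * n" "w < 2 * n" "X \<subseteq> {..<2 * n}" "card X = n - 2" "l \<in> X" "c \<notin> X"
      "w \<notin> X" "w \<noteq> c" "\<forall>x\<in>X. extremal n c x" "extremal n l w"
    unfolding star11_def by blast
  have fX: "finite X" using * finite_subset by blast
  show False
  proof (cases "n < c")
    case True
    then have "n < w" using * by (auto simp: extremal_def)
    have "insert c (insert w X) \<subseteq> {n<..<2 * n}"
      using * True \<open>n < w\<close> by (auto simp: extremal_def)
    then have "card (insert c (insert w X)) \<le> card {n<..<2 * n}" by (intro card_mono) auto
    then show False using * fX n by simp
  next
    case False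
    have "X \<subseteq> {..n} - {c} - {j. j \<le> n \<and> cubic n c j}"
      using * False by (auto simp: extremal_def)
    then have "card X \<le> card ({..n} - {c} - {j. j \<le> n \<and> cubic n c j})" by (intro card_mono) auto
    also have "\<dots> = card ({..n} - {c}) - card {j. j \<le> n \<and> cubic n c j}"
      by (intro card_Diff_subset) (auto simp: cubic_def)
    also have "\<dots> = n - 3" using False card_cubic[OF n, of c] by simp
    finally show False using * n by simp
  qed
qed

text \<open>For a hub above \<open>n\<close> the whole rim is a connected piece of the cubic graph,
  confined to a block of at most six vertices. For a hub up to \<open>n\<close>, at most three rim
  vertices are up to \<open>n\<close>, and those above \<open>n\<close> are pairwise non-adjacent.
  Any \<open>E\<close> avoiding the extremal graph is allowed, so smaller hosts are
  included.\<close>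

lemma extremal_no_wheel8:
  assumes n: "odd n" "5 \<le> n" and E: "\<And>x y. E x y \<Longrightarrow> x \<noteq> y \<and> \<not> extremal n x y"
  shows "\<not> wheel8 E V"
proof
  assume "wheel8 E V"
  then obtain h xs where xs: "length xs = 8" "distinct (h # xs)" "\<forall>x\<in>set xs. E h x"
      "successively E xs" "E (last xs) (hd xs)"
    unfolding wheel8_def by blast
  then obtain a b c d e f g i where l: "xs = [a, b, c, d, e, f, g, i]"
    by (auto simp: numeral_eq_Suc length_Suc_conv)
  have E': "n < x \<and> y \<le> n \<or> x \<le> n \<and> n < y \<or> x \<le> n \<and> y \<le> n \<and> cubic n x y" if "E x y" for x y
    using E[OF that] by (auto simp: extremal_def)
  have rim: "E a b" "E b c" "E c d" "E d e" "E e f" "E f g" "E g i" using xs l by auto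
  have hub: "E h a" "E h b" "E h c" "E h d" "E h e" "E h f" "E h g" "E h i" using xs l by auto
  show False
  proof (cases "n < h")
    case True
    then have le: "a \<le> n" "b \<le> n" "c \<le> n" "d \<le> n" "e \<le> n" "f \<le> n" "g \<le> n" "i \<le> n"
      using hub[THEN E'] by auto
    have "block n x = block n y" if "E x y" "x \<le> n" "y \<le> n" for x y
      using E'[OF that(1)] that by (auto simp: cubic_def)
    then have "set xs \<subseteq> {j. j \<le> n \<and> block n j = block n a}"
      using rim le l by simp
    then have "card (set xs) \<le> 6"
      using card_block_le[of n "block n a"] card_mono[of "{j. j \<le> n \<and> block n j = block n a}" "set xs"]
      by simp
    then show False using xs distinct_card[of xs] by simp
  next
    case False
    have c3: "card {j. j \<le> n \<and> cubic n h j} = 3" using False card_cubic[OF n, of h] by simp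
    have few: False if "distinct ys" "length ys = 4" "set ys \<subseteq> set xs" "\<forall>y\<in>set ys. y \<le> n" for ys
    proof -
      have "set ys \<subseteq> {j. j \<le> n \<and> cubic n h j}"
        using that xs(3) E'[of h] False by fastforce
      then have "card (set ys) \<le> 3" using c3 card_mono[of "{j. j \<le> n \<and> cubic n h j}" "set ys"] by simp
      then show False using that distinct_card[of ys] by simp
    qed
    \<comment> \<open>Four disjoint rim edges each have an end up to \<open>n\<close>, giving four
      cubic neighbours of the hub.\<close>
    obtain p where p: "p \<in> {a, b}" "p \<le> n" using E'[OF rim(1)] by auto
    obtain q where q: "q \<in> {c, d}" "q \<le> n" using E'[OF rim(3)] by auto
    obtain r where r: "r \<in> {e, f}" "r \<le> n" using E'[OF rim(5)] by auto
    obtain s where s: "s \<in> {g, i}" "s \<le> n" using E'[OF rim(7)] by auto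
    show False
      by (rule few[of "[p, q, r, s]"]) (use p q r s xs(2) l in auto)
  qed
qed

section \<open>Embeddings\<close>

text \<open>A subgraph of \<open>with_proj F\<close> inherits \<open>fst\<close> and
  \<open>snd\<close> as its end maps, so the arc map of an isomorphism is determined by its vertex
  map.\<close>

lemma contains_copy_iff_embedding:
  assumes "pair_wf_digraph F" "pair_wf_digraph G"
  shows "contains_copy F G \<longleftrightarrow> (\<exists>f. inj_on f (pverts G) \<and> f ` pverts G \<subseteq> pverts F \<and>
     (\<forall>x y. (x, y) \<in> parcs G \<longrightarrow> (f x, f y) \<in> parcs F))"
proof
  interpret F: pair_wf_digraph F by fact
  interpret G: pair_wf_digraph G by fact
  assume "contains_copy F G"
  then obtain hom where sub: "subgraph (app_iso hom (with_proj G)) (with_proj F)"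
      and iso: "pre_digraph.digraph_isomorphism (with_proj G) hom"
    by (auto simp: contains_copy_def digraph_iso_def)
  have proj: "iso_tail hom = fst" "iso_head hom = snd"
    using sub by (auto simp: subgraph_def compatible_def)
  have "(iso_verts hom x, iso_verts hom y) \<in> parcs F" if "(x, y) \<in> parcs G" for x y
  proof -
    have "iso_arcs hom (x, y) \<in> parcs F" using sub that by (auto simp: subgraph_def)
    moreover have "iso_arcs hom (x, y) = (iso_verts hom x, iso_verts hom y)"
      using iso that proj by (auto simp: pre_digraph.digraph_isomorphism_def prod_eq_iff)
    ultimately show ?thesis by simp
  qed
  moreover have "inj_on (iso_verts hom) (pverts G)" "iso_verts hom ` pverts G \<subseteq> pverts F"
    using iso sub by (auto simp: pre_digraph.digraph_isomorphism_def subgraph_def)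
  ultimately show "\<exists>f. inj_on f (pverts G) \<and> f ` pverts G \<subseteq> pverts F \<and>
     (\<forall>x y. (x, y) \<in> parcs G \<longrightarrow> (f x, f y) \<in> parcs F)" by blast
next
  interpret F: pair_wf_digraph F by fact
  interpret G: pair_wf_digraph G by fact
  assume "\<exists>f. inj_on f (pverts G) \<and> f ` pverts G \<subseteq> pverts F \<and>
     (\<forall>x y. (x, y) \<in> parcs G \<longrightarrow> (f x, f y) \<in> parcs F)"
  then obtain f where f: "inj_on f (pverts G)" "f ` pverts G \<subseteq> pverts F"
      "\<And>x y. (x, y) \<in> parcs G \<Longrightarrow> (f x, f y) \<in> parcs F" by blast
  define hom :: "('b, 'b \<times> 'b, 'a, 'a \<times> 'a) digraph_isomorphism" where
    "hom = \<lparr> iso_verts = f, iso_arcs = map_prod f f, iso_head = snd, iso_tail = fst \<rparr>"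
  have inj: "inj_on (map_prod f f) (parcs G)"
    using f(1) G.wellformed' by (auto simp: inj_on_def)
  have iso: "pre_digraph.digraph_isomorphism (with_proj G) hom"
    using f(1) inj G.wf_digraph_axioms
    by (auto simp: pre_digraph.digraph_isomorphism_def hom_def)
  have "wf_digraph (app_iso hom (with_proj G))"
    by (rule wf_digraph.wf_digraphI_app_iso[OF _ iso]) (rule G.wf_digraph_axioms)
  then have "subgraph (app_iso hom (with_proj G)) (with_proj F)"
    using f F.wf_digraph_axioms
    by (auto simp: subgraph_def compatible_def hom_def)
  then show "contains_copy F G"
    using iso by (auto simp: contains_copy_def digraph_iso_def)
qed

lemma pair_wf_complement: "pair_wf_digraph (complement_graph F)"
  by unfold_locales (auto simp: complement_graph_def)

lemma pair_wf_wheel: "pair_wf_digraph (wheel_graph k)"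
  by unfold_locales (auto simp: wheel_graph_def cycle_graph_def)

lemma subdivided_star_verts: "3 \<le> n \<Longrightarrow> pverts (subdivided_star n) = {..<n}"
  by (auto simp: subdivided_star_def star_graph_def subdivide.simps)

lemma subdivided_star_arcs:
  "parcs (subdivided_star n) = {0} \<times> {2..<n - 1} \<union> {2..<n - 1} \<times> {0} \<union>
     {(0, n - 1), (n - 1, 0), (n - 1, 1), (1, n - 1)}"
  by (auto simp: subdivided_star_def star_graph_def subdivide.simps)

lemma pair_wf_subdivided_star: "3 \<le> n \<Longrightarrow> pair_wf_digraph (subdivided_star n)"
  by unfold_locales (auto simp: subdivided_star_verts subdivided_star_arcs)

lemma contains_wheel8_iff:
  assumes "pair_wf_digraph F" "sym (parcs F)"
  shows "contains_copy F (wheel_graph 8) \<longleftrightarrow> wheel8 (\<lambda>x y. (x, y) \<in> parcs F) (pverts F)"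
proof
  assume "contains_copy F (wheel_graph 8)"
  then obtain f where f: "inj_on f (pverts (wheel_graph 8))" "f ` pverts (wheel_graph 8) \<subseteq> pverts F"
      "\<And>x y. (x, y) \<in> parcs (wheel_graph 8) \<Longrightarrow> (f x, f y) \<in> parcs F"
    using contains_copy_iff_embedding[OF assms(1) pair_wf_wheel] by blast
  have v: "pverts (wheel_graph 8) = {..8}" by (auto simp: wheel_graph_def cycle_graph_def)
  have eq: "f i = f j \<longleftrightarrow> i = j" if "i \<le> 8" "j \<le> 8" for i j
    using f(1) that by (auto simp: v inj_on_def)
  have hub: "(f 8, f i) \<in> parcs F" if "i < 8" for i
    using that by (intro f(3)) (auto simp: wheel_graph_def cycle_graph_def)
  have rim: "(f i, f ((i + 1) mod 8)) \<in> parcs F" if "i < 8" for i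
    using that by (intro f(3)) (auto simp: wheel_graph_def cycle_graph_def)
  let ?xs = "map f [0, 1, 2, 3, 4, 5, 6, 7]"
  have "distinct (f 8 # ?xs)" by (simp add: eq)
  moreover have "set (f 8 # ?xs) \<subseteq> pverts F" using f(2) by (auto simp: v)
  moreover have "\<forall>x\<in>set ?xs. (f 8, x) \<in> parcs F" by (simp add: hub)
  moreover have "successively (\<lambda>x y. (x, y) \<in> parcs F) ?xs" "(last ?xs, hd ?xs) \<in> parcs F"
    using rim[of 0] rim[of 1] rim[of 2] rim[of 3] rim[of 4] rim[of 5] rim[of 6] rim[of 7]
    by (simp_all flip: numeral_2_eq_2)
  ultimately show "wheel8 (\<lambda>x y. (x, y) \<in> parcs F) (pverts F)"
    unfolding wheel8_def by (intro exI[of _ "f 8"] exI[of _ ?xs]) simp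
next
  assume "wheel8 (\<lambda>x y. (x, y) \<in> parcs F) (pverts F)"
  then obtain h xs where xs: "length xs = 8" "distinct (h # xs)" "set (h # xs) \<subseteq> pverts F"
      "\<forall>x\<in>set xs. (h, x) \<in> parcs F" "successively (\<lambda>x y. (x, y) \<in> parcs F) xs"
      "(last xs, hd xs) \<in> parcs F"
    unfolding wheel8_def by blast
  define f where "f i = (xs @ [h]) ! i" for i
  have v: "pverts (wheel_graph 8) = {..<9}" by (auto simp: wheel_graph_def cycle_graph_def)
  have "inj_on f {..<9}"
    using xs(1,2) by (auto simp: f_def inj_on_def nth_eq_iff_index_eq[of "xs @ [h]"])
  moreover have "f i \<in> set (xs @ [h])" if "i < 9" for i
    unfolding f_def by (rule nth_mem) (use that xs(1) in simp)
  then have "f ` {..<9} \<subseteq> pverts F" using xs(3) by fastforce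
  moreover have "(f x, f y) \<in> parcs F" if a: "(x, y) \<in> parcs (wheel_graph 8)" for x y
  proof -
    have s: "(q, p) \<in> parcs F" if "(p, q) \<in> parcs F" for p q using assms(2) that by (rule symD)
    have hub: "(f 8, f i) \<in> parcs F" if "i < 8" for i
      using that xs(1,4) by (auto simp: f_def nth_append)
    have rim: "(f i, f (Suc i mod 8)) \<in> parcs F" if "i < 8" for i
    proof (cases "i = 7")
      case True
      moreover have "xs \<noteq> []" using xs(1) by auto
      ultimately show ?thesis using xs(1,6) by (auto simp: f_def nth_append last_conv_nth hd_conv_nth)
    next
      case False
      then show ?thesis using that xs(1,5) by (auto simp: f_def nth_append successively_conv_nth)
    qed
    show ?thesis using a hub rim s by (auto simp: wheel_graph_def cycle_graph_def)
  qed
  ultimately show "contains_copy F (wheel_graph 8)"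
    using contains_copy_iff_embedding[OF assms(1) pair_wf_wheel] v by metis
qed

text \<open>The subdividing vertex \<open>n - 1\<close> is the neighbour \<open>l\<close> of the
  centre 0, and the vertex 1, cut off from the centre, becomes the pendant \<open>w\<close>.\<close>

lemma contains_subdivided_star_iff:
  assumes "pair_wf_digraph F" "sym (parcs F)" "3 \<le> n"
  shows "contains_copy F (subdivided_star n) \<longleftrightarrow> star11 (\<lambda>x y. (x, y) \<in> parcs F) (pverts F) n"
proof
  assume "contains_copy F (subdivided_star n)"
  then obtain f where f: "inj_on f {..<n}" "f ` {..<n} \<subseteq> pverts F"
      "\<And>x y. (x, y) \<in> parcs (subdivided_star n) \<Longrightarrow> (f x, f y) \<in> parcs F"
    using contains_copy_iff_embedding[OF assms(1) pair_wf_subdivided_star[OF assms(3)]]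
      subdivided_star_verts[OF assms(3)] by auto
  have eq: "f i = f j \<longleftrightarrow> i = j" if "i < n" "j < n" for i j
    using f(1) that by (auto simp: inj_on_def)
  let ?X = "f ` {2..<n}"
  have "card ?X = n - 2" using f(1) by (subst card_image) (auto intro: inj_on_subset)
  moreover have "(f 0, f x) \<in> parcs F" if "x \<in> {2..<n}" for x
    using that by (intro f(3)) (auto simp: subdivided_star_arcs)
  moreover have "(f (n - 1), f 1) \<in> parcs F"
    by (intro f(3)) (auto simp: subdivided_star_arcs)
  moreover have "f 0 \<in> pverts F" "f 1 \<in> pverts F" "?X \<subseteq> pverts F" using f(2) assms(3) by auto
  moreover have "f (n - 1) \<in> ?X" using assms(3) by auto
  moreover have "f 0 \<notin> ?X" "f 1 \<notin> ?X" "f 1 \<noteq> f 0" using eq assms(3) by auto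
  ultimately show "star11 (\<lambda>x y. (x, y) \<in> parcs F) (pverts F) n"
    unfolding star11_def
    by (intro exI[of _ "f 0"] exI[of _ "f (n - 1)"] exI[of _ "f 1"] exI[of _ ?X]) auto
next
  assume "star11 (\<lambda>x y. (x, y) \<in> parcs F) (pverts F) n"
  then obtain c l w X where *: "c \<in> pverts F" "w \<in> pverts F" "X \<subseteq> pverts F" "card X = n - 2" "l \<in> X"
      "c \<notin> X" "w \<notin> X" "w \<noteq> c" "\<forall>x\<in>X. (c, x) \<in> parcs F" "(l, w) \<in> parcs F"
    unfolding star11_def by blast
  have fX: "finite X" using * assms(3) by (intro card_ge_0_finite) simp
  have "card (X - {l}) = card {2..<n - 1}" using * fX by simp
  then obtain g where g: "bij_betw g {2..<n - 1} (X - {l})"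
    using fX by (metis finite_Diff finite_atLeastLessThan finite_same_card_bij)
  define f where "f i = (if i = 0 then c else if i = 1 then w else if i = n - 1 then l else g i)" for i
  have gX: "g i \<in> X" "g i \<noteq> l" if "i \<in> {2..<n - 1}" for i
    using bij_betwE[OF g] that by auto
  have gi: "g i = g j \<longleftrightarrow> i = j" if "i \<in> {2..<n - 1}" "j \<in> {2..<n - 1}" for i j
    using g that by (auto simp: bij_betw_def inj_on_def)
  have f: "f 0 = c" "f 1 = w" "f (n - 1) = l" "\<And>i. i \<in> {2..<n - 1} \<Longrightarrow> f i = g i"
    using assms(3) by (auto simp: f_def)
  have "f i \<noteq> f j" if ij: "i < j" "j < n" for i j
  proof -
    have "g i \<in> X" "g i \<noteq> l" if "i \<noteq> 0" "i \<noteq> 1" "i \<noteq> n - 1" "i < n" for i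
      using gX[of i] that by auto
    from ij *(5-8) assms(3) this[of i] this[of j] gi[of i j] show ?thesis
      unfolding f_def by (auto split: if_splits)
  qed
  then have "inj_on f {..<n}" by (intro linorder_inj_onI) auto
  moreover have "f i \<in> pverts F" if "i < n" for i
    using gX[of i] that *(1-3,5) assms(3) unfolding f_def by auto
  then have "f ` {..<n} \<subseteq> pverts F" by blast
  moreover have "(f x, f y) \<in> parcs F" if a: "(x, y) \<in> parcs (subdivided_star n)" for x y
  proof -
    have s: "(q, p) \<in> parcs F" if "(p, q) \<in> parcs F" for p q using assms(2) that by (rule symD)
    have "(c, g i) \<in> parcs F" "(g i, c) \<in> parcs F" if "i \<in> {2..<n - 1}" for i
      using *(9) s gX(1)[OF that] by blast+
    moreover have "(c, l) \<in> parcs F" "(l, c) \<in> parcs F" "(l, w) \<in> parcs F" "(w, l) \<in> parcs F"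
      using * s by blast+
    ultimately show ?thesis using a f by (auto simp: subdivided_star_arcs)
  qed
  ultimately show "contains_copy F (subdivided_star n)"
    using contains_copy_iff_embedding[OF assms(1) pair_wf_subdivided_star[OF assms(3)]]
      subdivided_star_verts[OF assms(3)] by auto
qed

lemma star11_mono:
  "star11 F V n \<Longrightarrow> V \<subseteq> V' \<Longrightarrow> (\<And>x y. F x y \<Longrightarrow> F' x y) \<Longrightarrow> star11 F' V' n"
  unfolding star11_def by (meson subset_trans subsetD)

theorem theorem7:
  fixes n :: nat
  assumes "odd n" and "n \<ge> 5"
  shows "ramsey_number (subdivided_star n) (wheel_graph 8) = 2 * n + 1"
  unfolding ramsey_number_def
proof (rule Least_equality, intro conjI allI impI)
  show "0 < 2 * n + 1" by simp
next
  fix F :: "nat pair_pre_digraph"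
  assume F: "pair_graph F \<and> card (pverts F) = 2 * n + 1"
  interpret pair_graph F using F by blast
  let ?G = "complement_graph F"
  have symF: "sym (parcs F)" using pair_sym_arcs by (simp add: symmetric_def)
  then have symG: "sym (parcs ?G)" by (auto simp: complement_graph_def sym_def)
  have "wheel8 (\<lambda>x y. (x, y) \<in> parcs ?G) (pverts F) \<or> star11 (\<lambda>x y. (x, y) \<in> parcs F) (pverts F) n"
    using assms F pair_finite_verts symG
    by (intro wheel8_or_star11) (auto simp: complement_graph_def dest: symD)
  then show "contains_copy F (subdivided_star n) \<or> contains_copy ?G (wheel_graph 8)"
    using contains_wheel8_iff[OF pair_wf_complement symG] assms(2)
      contains_subdivided_star_iff[OF pair_wf_digraph_axioms symF, of n]
    by (auto simp: complement_graph_def)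
next
  fix N
  assume N: "0 < N \<and> (\<forall>F :: nat pair_pre_digraph. pair_graph F \<and> card (pverts F) = N \<longrightarrow>
    contains_copy F (subdivided_star n) \<or> contains_copy (complement_graph F) (wheel_graph 8))"
  show "2 * n + 1 \<le> N"
  proof (rule ccontr)
    assume "\<not> 2 * n + 1 \<le> N"
    then have sub: "{..<N} \<subseteq> {..<2 * n}" by auto
    \<comment> \<open>The extremal graph is restricted to its first \<open>N\<close> vertices, which
      refutes all \<open>N\<close> up to \<open>2 * n\<close> at once, as restriction creates
      neither a star nor a wheel.\<close>
    define F where "F = \<lparr> pverts = {..<N}, parcs = {(i, j). i < N \<and> j < N \<and> extremal n i j} \<rparr>"
    let ?G = "complement_graph F"
    have symF: "sym (parcs F)"
      by (auto simp: F_def extremal_def sym_def dest: cubic_sym)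
    then have symG: "sym (parcs ?G)" by (auto simp: complement_graph_def sym_def)
    have "parcs F \<subseteq> {..<N} \<times> {..<N}" by (auto simp: F_def)
    then have "finite (parcs F)" by (rule finite_subset) simp
    then have F: "pair_graph F"
      using symF by unfold_locales (auto simp: F_def extremal_def symmetric_def)
    then interpret pair_graph F .
    have "contains_copy F (subdivided_star n) \<or> contains_copy ?G (wheel_graph 8)"
      using N F by (simp add: F_def)
    then have "star11 (\<lambda>x y. (x, y) \<in> parcs F) {..<N} n \<or> wheel8 (\<lambda>x y. (x, y) \<in> parcs ?G) {..<N}"
      using contains_wheel8_iff[OF pair_wf_complement symG] assms(2)
        contains_subdivided_star_iff[OF pair_wf_digraph_axioms symF, of n]
      by (auto simp: complement_graph_def F_def)
    moreover have "\<not> star11 (\<lambda>x y. (x, y) \<in> parcs F) {..<N} n"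
    proof
      assume "star11 (\<lambda>x y. (x, y) \<in> parcs F) {..<N} n"
      then have "star11 (extremal n) {..<2 * n} n" by (rule star11_mono[OF _ sub]) (simp add: F_def)
      then show False using extremal_no_star11[OF assms] by contradiction
    qed
    moreover have "\<not> wheel8 (\<lambda>x y. (x, y) \<in> parcs ?G) {..<N}"
      by (rule extremal_no_wheel8[OF assms]) (auto simp: complement_graph_def F_def)
    ultimately show False by blast
  qed
qed

end
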